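(* Let $b_\triangle(n)$ be the number of similar sublattices of index $n$ of the hexagonal lattice $\mathbb{Z}[\rho]\subset\mathbb{C}\cong\mathbb{R}^2$, $\rho=\frac{1+\mathrm{i}\sqrt3}{2}$, and $b^{\mathsf{pr}}_\triangle(n)$ the number of primitive similar sublattices of index $n$. Then, as $x\to\infty$, $$\sum_{n\le x}b_\triangle(n)=L(1,\chi_{-3})\,x+O(\sqrt x)=\frac{\pi}{3\sqrt3}x+O(\sqrt x),$$ $$\sum_{n\le x}b^{\mathsf{pr}}_\triangle(n)=\frac{L(1,\chi_{-3})}{\zeta(2)}x+O(\sqrt x\log x)=\frac{2}{\pi\sqrt3}x+O(\sqrt x\log x).$$
   Context: A similar sublattice of a lattice $\Gamma$ is a sublattice of the form $\alpha R\Gamma\subseteq\Gamma$ with $\alpha>0$ and $R$ orthogonal; it is primitive if it is not of the form $m\Lambda$ with $\Lambda$ a similar sublattice of $\Gamma$ and $m\ge2$ an integer. Equivalently, $\sum_n b_\triangle(n)n^{-s}=\zeta(s)L(s,\chi_{-3})$ and $\sum_n b^{\mathsf{pr}}_\triangle(n)n^{-s}=\zeta(s)L(s,\chi_{-3})/\zeta(2s)$, where $L(s,\chi_{-3})=\sum_n\chi_{-3}(n)n^{-s}$ with $\chi_{-3}(n)=0$ if $3\mid n$, $1$ if $n\equiv1\pmod3$, $-1$ if $n\equiv2\pmod3$. *)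

theory Defs
  imports "HOL-Analysis.Analysis" "HOL-Library.Landau_Symbols"
begin

definition similar_sublattice :: "'a::euclidean_space set \<Rightarrow> 'a set \<Rightarrow> bool" where
  "similar_sublattice \<Gamma> \<Lambda> \<longleftrightarrow>
     (\<exists>(\<alpha>::real) R. \<alpha> > 0 \<and> orthogonal_transformation R \<and>
        \<Lambda> = (\<lambda>z. \<alpha> *\<^sub>R R z) ` \<Gamma> \<and> \<Lambda> \<subseteq> \<Gamma>)"

definition primitive_similar_sublattice :: "'a::euclidean_space set \<Rightarrow> 'a set \<Rightarrow> bool" where
  "primitive_similar_sublattice \<Gamma> \<Lambda> \<longleftrightarrow>
     similar_sublattice \<Gamma> \<Lambda> \<and>
     \<not> (\<exists>(m::int) \<Lambda>'. m \<ge> 2 \<and> similar_sublattice \<Gamma> \<Lambda>' \<and> \<Lambda> = (\<lambda>z. of_int m *\<^sub>R z) ` \<Lambda>')"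

text \<open>The group index, with value 0 if the index is infinite.\<close>

definition lattice_index :: "'a::ab_group_add set \<Rightarrow> 'a set \<Rightarrow> nat" where
  "lattice_index \<Gamma> \<Lambda> = card (\<Gamma> // {(x, y). x \<in> \<Gamma> \<and> y \<in> \<Gamma> \<and> x - y \<in> \<Lambda>})"

definition \<rho> :: complex where
  "\<rho> = (1 + \<i> * of_real (sqrt 3)) / 2"

text \<open>Since \<open>\<rho>\<^sup>2 = \<rho> - 1\<close>, the ring \<open>\<int>[\<rho>]\<close> is the \<open>\<int>\<close>-span of 1 and \<open>\<rho>\<close>.\<close>

definition hexagonal_lattice :: "complex set" where
  "hexagonal_lattice = {of_int a + of_int b * \<rho> | a b :: int. True}"

definition b_hex :: "nat \<Rightarrow> nat" where
  "b_hex n = card {\<Lambda>. similar_sublattice hexagonal_lattice \<Lambda> \<and>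
                       lattice_index hexagonal_lattice \<Lambda> = n}"

definition b_hex_pr :: "nat \<Rightarrow> nat" where
  "b_hex_pr n = card {\<Lambda>. primitive_similar_sublattice hexagonal_lattice \<Lambda> \<and>
                          lattice_index hexagonal_lattice \<Lambda> = n}"

definition chi3 :: "nat \<Rightarrow> real" where
  "chi3 n = (if n mod 3 = 0 then 0 else if n mod 3 = 1 then 1 else -1)"

text \<open>The series are indexed from 1; \<open>suminf\<close> is the limit of the partial sums, so it covers
  the conditionally convergent case \<open>s = 1\<close> of the L-series.\<close>

definition L_chi3 :: "real \<Rightarrow> real" where
  "L_chi3 s = (\<Sum>n. chi3 (Suc n) / real (Suc n) powr s)"

definition zeta_series :: "real \<Rightarrow> real" where
  "zeta_series s = (\<Sum>n. 1 / real (Suc n) powr s)"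

end

theory Submission
  imports Defs "HOL-Computational_Algebra.Squarefree"
begin

text \<open>Every similar sublattice of \<open>\<Gamma> = \<int>[\<rho>]\<close> is an ideal \<open>c\<Gamma>\<close> with \<open>c \<noteq> 0\<close>: a reflection can be
  absorbed because \<open>\<Gamma>\<close> is closed under conjugation. Its index is \<open>\<bar>c\<bar>\<^sup>2\<close>, it has six generators, and
  it is primitive iff the coordinates of \<open>c\<close> are coprime. So the first sum is one sixth of the
  number of nonzero lattice points in a disc of radius \<open>\<surd>x\<close>, which an area comparison determines up
  to \<open>O(\<surd>x)\<close>. Sorting the points by the gcd of their coordinates and Moebius inversion turn this into
  the count of coprime points; no infinite Dirichlet series is needed, since the partial sums of
  \<open>\<mu>(m) / m\<^sup>2\<close> are controlled by the same finite inversion identity.\<close>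

section \<open>The Moebius function\<close>

text \<open>The main terms come from geometry alone: the disc has area pi x and a lattice cell has
  area \<open>sqrt 3 / 2\<close>, so it holds about \<open>2 * pi / sqrt 3 * x\<close> points, and
  division by six gives \<open>pi / (3 * sqrt 3)\<close>. That this is also the value of the
  L-series at 1 is a separate computation; no factorization of a Dedekind zeta function enters. For
  coprime points two errors meet. The point count at x/m^2 is off by O(sqrt x / m), which sums over
  m \<le> sqrt x to O(sqrt x log x). Replacing the partial sum of \<open>moebius_mu m / m^2\<close>
  up to N by 1/zeta(2) costs O(x log N / N) with the bound that finite inversion yields. This rate
  is not optimal, but as N is about sqrt x it has the order of the first error and costs
  nothing.\<close>

definition moebius_mu :: "nat \<Rightarrow> real" where
  "moebius_mu n = (if squarefree n then (-1) ^ card (prime_factors n) else 0)"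

lemma moebius_mu_1 [simp]: "moebius_mu (Suc 0) = 1"
  by (simp add: moebius_mu_def)

lemma abs_moebius_mu_le: "\<bar>moebius_mu n\<bar> \<le> 1"
  by (simp add: moebius_mu_def power_abs)

lemma moebius_mu_prime_mult:
  assumes "prime p" "\<not> p dvd d" "squarefree d"
  shows "squarefree (p * d)" "moebius_mu (p * d) = - moebius_mu d"
proof -
  have "d \<noteq> 0" using assms(3) by (intro notI) simp
  have "coprime p d" using assms(1,2) by (rule prime_imp_coprime)
  then show sf: "squarefree (p * d)"
    using assms by (simp add: squarefree_mult_coprime squarefree_prime)
  have "prime_factors (p * d) = insert p (prime_factors d)"
    using assms \<open>d \<noteq> 0\<close> by (simp add: prime_factorization_mult prime_factorization_prime)
  moreover have "p \<notin> prime_factors d"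
    using assms(2) by (auto dest: in_prime_factors_imp_dvd)
  ultimately have "card (prime_factors (p * d)) = Suc (card (prime_factors d))"
    by simp
  then show "moebius_mu (p * d) = - moebius_mu d"
    using sf assms(3) by (simp add: moebius_mu_def)
qed

text \<open>For a prime \<open>p\<close> dividing \<open>n\<close>, the squarefree divisors of \<open>n\<close> pair up as
  \<open>d, p * d\<close> with opposite signs.\<close>

lemma sum_moebius_mu_divisors:
  fixes n :: nat
  assumes "n > 1"
  shows "(\<Sum>d | d dvd n. moebius_mu d) = 0"
proof -
  obtain p where p: "prime p" "p dvd n"
    using assms prime_factor_nat[of n] by auto
  let ?S = "{d. d dvd n \<and> squarefree d}"
  define f where "f d = (if p dvd d then d div p else p * d)" for d
  have fin: "finite {d. d dvd n}" using assms by (intro finite_divisors_nat) auto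
  have "p > 0" using p(1) by (rule prime_gt_0_nat)
  have key: "f d \<in> ?S \<and> f (f d) = d \<and> moebius_mu (f d) = - moebius_mu d" if "d \<in> ?S" for d
  proof (cases "p dvd d")
    case True
    then obtain e where e: "d = p * e" by auto
    have "\<not> p dvd e"
    proof
      assume "p dvd e"
      then have "p ^ 2 dvd d" using e by (auto simp: power2_eq_square)
      then show False using that p(1) squarefreeD[of d p] by auto
    qed
    moreover have "squarefree e" using that e squarefree_multD(2)[of p e] by simp
    moreover have "e dvd n" using that e by (auto intro: dvd_trans)
    ultimately show ?thesis
      using e \<open>p > 0\<close> moebius_mu_prime_mult[OF p(1), of e] by (simp_all add: f_def)
  next
    case False
    have "p * d dvd n"
      using False p that by (intro divides_mult prime_imp_coprime) auto
    then show ?thesis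
      using False \<open>p > 0\<close> that moebius_mu_prime_mult[OF p(1) False] by (simp_all add: f_def)
  qed
  have "(\<Sum>d | d dvd n. moebius_mu d) = sum moebius_mu ?S"
    by (rule sum.mono_neutral_right[OF fin]) (auto simp: moebius_mu_def)
  moreover have "sum moebius_mu ?S = (\<Sum>d\<in>?S. - moebius_mu d)"
    by (rule sum.reindex_bij_witness[of _ f f]) (simp_all only: key minus_minus)
  ultimately show ?thesis unfolding sum_negf by linarith
qed

text \<open>Collecting the pairs (m, k) by their product n turns the left side into the sum over n
  \<le> N of g n times the divisor sum of \<open>moebius_mu\<close>, which vanishes except at n = 1.
  It serves twice: for inverse squares and for lattice point counts.\<close>

lemma moebius_inversion_multiples:
  fixes g :: "nat \<Rightarrow> real"
  assumes "N > 0"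
  shows "(\<Sum>m=1..N. moebius_mu m * (\<Sum>k=1..N div m. g (m * k))) = g 1"
proof -
  have "(\<Sum>m=1..N. moebius_mu m * (\<Sum>k=1..N div m. g (m * k)))
      = (\<Sum>(m, k)\<in>Sigma {1..N} (\<lambda>m. {1..N div m}). moebius_mu m * g (m * k))"
    by (simp add: sum.Sigma sum_distrib_left)
  also have "\<dots> = (\<Sum>(n, d)\<in>Sigma {1..N} (\<lambda>n. {d. d dvd n}). moebius_mu d * g n)"
  proof (rule sum.reindex_bij_witness[of _ "\<lambda>(n, d). (d, n div d)" "\<lambda>(m, k). (m * k, m)"], goal_cases)
    case (2 x)
    then show ?case
      by (auto simp: less_eq_div_iff_mult_less_eq mult.commute)
  next
    case (4 x)
    then obtain n d where x: "x = (n, d)" "d dvd n" "1 \<le> n" "n \<le> N" by auto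
    have "d > 0" "d \<le> n" "n div d > 0" using x by (auto intro!: Nat.gr0I dvd_imp_le)
    then show ?case using x by (auto intro: div_le_mono)
  qed auto
  also have "\<dots> = (\<Sum>n=1..N. (\<Sum>d | d dvd n. moebius_mu d) * g n)"
    by (subst sum.Sigma[symmetric]) (auto simp: sum_distrib_right)
  also have "\<dots> = (\<Sum>n\<in>{1}. (\<Sum>d | d dvd n. moebius_mu d) * g n)"
    using assms by (intro sum.mono_neutral_right) (auto simp: sum_moebius_mu_divisors)
  finally show ?thesis by simp
qed

section \<open>Rate of convergence of the partial sums of \<open>moebius_mu m / m^2\<close>\<close>

lemma harm_le_ln: "n > 0 \<Longrightarrow> harm n \<le> 1 + ln (real n)"
  \<comment> \<open>The difference \<open>harm n - ln n\<close> decreases from its value 1 at n = 1,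
    which is index 0 of the shifted sequence.\<close>
  using decseqD[OF decseq_harm_diff_ln, of 0 "n - 1"] by (simp add: harm_expand)

text \<open>The partial sums increase to pi^2/6, and they decrease to it once 2/(j + 1) is added,
  because each new term 1/(j + 1)^2 is at most the telescoping 2/(j + 1) - 2/(j + 2). The
  denominator j + 1 suits the later choice j = \<open>N div m\<close>, where j + 1 \<ge>
  N/m.\<close>

lemma sum_inverse_squares_bounds:
  "(\<Sum>k=1..j. 1 / (real k)\<^sup>2) \<le> pi\<^sup>2 / 6"
  "pi\<^sup>2 / 6 \<le> (\<Sum>k=1..j. 1 / (real k)\<^sup>2) + 2 / (real j + 1)"
proof -
  define s where "s j = (\<Sum>k=1..j. 1 / (real k)\<^sup>2)" for j
  have s_Suc: "s (Suc j) = s j + 1 / (real j + 1)\<^sup>2" for j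
    by (simp add: s_def add.commute)
  have s_eq: "s = (\<lambda>n. \<Sum>k<n. 1 / (real (k + 1))\<^sup>2)"
  proof
    show "s n = (\<Sum>k<n. 1 / (real (k + 1))\<^sup>2)" for n
      by (induction n) (simp_all add: s_Suc add.commute, simp add: s_def)
  qed
  have lim: "s \<longlonglongrightarrow> pi\<^sup>2 / 6"
    using inverse_squares_sums unfolding s_eq sums_def by (simp add: add.commute)
  have "incseq s"
    by (rule incseq_SucI) (simp add: s_Suc)
  from incseq_le[OF this lim] show "(\<Sum>k=1..j. 1 / (real k)\<^sup>2) \<le> pi\<^sup>2 / 6"
    by (simp add: s_def)
  have "decseq (\<lambda>j. s j + 2 / (real j + 1))"
  proof (rule decseq_SucI)
    fix j
    have "1 / (real j + 1)\<^sup>2 \<le> 2 / ((real j + 1) * (real j + 2))"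
    proof -
      have "(real j + 1) * (real j + 2) \<le> 2 * (real j + 1)\<^sup>2"
        by (simp add: algebra_simps power2_eq_square)
      then show ?thesis by (simp add: divide_simps)
    qed
    also have "\<dots> = 2 / (real j + 1) - 2 / (real j + 2)"
      by (simp add: field_simps)
    finally show "s (Suc j) + 2 / (real (Suc j) + 1) \<le> s j + 2 / (real j + 1)"
      by (simp add: s_Suc add.commute)
  qed
  moreover have "(\<lambda>j. 2 / (real j + 1)) \<longlonglongrightarrow> 0"
    using LIMSEQ_Suc[OF lim_const_over_n[of 2]] by (simp add: add.commute)
  then have "(\<lambda>j. s j + 2 / (real j + 1)) \<longlonglongrightarrow> pi\<^sup>2 / 6"
    using tendsto_add[OF lim] by fastforce
  ultimately have "pi\<^sup>2 / 6 \<le> s j + 2 / (real j + 1)" by (rule decseq_ge)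
  then show "pi\<^sup>2 / 6 \<le> (\<Sum>k=1..j. 1 / (real k)\<^sup>2) + 2 / (real j + 1)"
    by (simp add: s_def)
qed

text \<open>Apply \<open>moebius_inversion_multiples\<close> to \<open>g n = 1 / n\<^sup>2\<close> and replace the inner sums by
  \<open>\<zeta>(2)\<close>.\<close>

lemma sum_moebius_mu_over_squares:
  assumes "N > 0"
  shows "\<bar>pi\<^sup>2 / 6 * (\<Sum>m=1..N. moebius_mu m / (real m)\<^sup>2) - 1\<bar> \<le> 2 * harm N / real N"
proof -
  define s where "s j = (\<Sum>k=1..j. 1 / (real k)\<^sup>2)" for j :: nat
  have "1 = (\<Sum>m=1..N. moebius_mu m * (\<Sum>k=1..N div m. 1 / (real (m * k))\<^sup>2))"
    using moebius_inversion_multiples[OF assms, of "\<lambda>n. 1 / (real n)\<^sup>2"] by simp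
  also have "\<dots> = (\<Sum>m=1..N. moebius_mu m / (real m)\<^sup>2 * s (N div m))"
    by (simp add: s_def sum_distrib_left power_mult_distrib)
  finally have "pi\<^sup>2 / 6 * (\<Sum>m=1..N. moebius_mu m / (real m)\<^sup>2) - 1
      = (\<Sum>m=1..N. moebius_mu m / (real m)\<^sup>2 * (pi\<^sup>2 / 6 - s (N div m)))"
    by (simp add: sum_distrib_left sum_subtractf right_diff_distrib mult.commute)
  also have "\<bar>\<dots>\<bar> \<le> (\<Sum>m=1..N. 2 / real N * inverse (real m))"
  proof (rule order.trans[OF sum_abs sum_mono])
    fix m assume m: "m \<in> {1..N}"
    have "real N / real m \<le> real (N div m) + 1"
    proof -
      have "N \<le> m + N div m * m" using m dividend_less_div_times[of m N] by simp
      then have "real N \<le> real (m + N div m * m)" by (simp only: of_nat_le_iff)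
      then show ?thesis using m by (simp add: divide_le_eq algebra_simps)
    qed
    \<comment> \<open>The inner sum misses zeta(2) by at most 2m/N; with the weight 1/m^2 this
      leaves 2/(N m), whose sum over m is harmonic.\<close>
    then have "2 / (real (N div m) + 1) \<le> 2 / (real N / real m)"
      using m by (intro divide_left_mono mult_pos_pos) auto
    then have 1: "\<bar>pi\<^sup>2 / 6 - s (N div m)\<bar> \<le> 2 * real m / real N"
      using sum_inverse_squares_bounds[of "N div m"] by (simp add: s_def)
    have "\<bar>moebius_mu m / (real m)\<^sup>2\<bar> \<le> 1 / (real m)\<^sup>2"
      using abs_moebius_mu_le[of m] by (simp add: divide_right_mono)
    then have "\<bar>moebius_mu m / (real m)\<^sup>2 * (pi\<^sup>2 / 6 - s (N div m))\<bar>
        \<le> 1 / (real m)\<^sup>2 * (2 * real m / real N)"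
      unfolding abs_mult using 1 by (intro mult_mono) auto
    also have "\<dots> = 2 / real N * inverse (real m)"
      using m by (simp add: field_simps power2_eq_square)
    finally show "\<bar>moebius_mu m / (real m)\<^sup>2 * (pi\<^sup>2 / 6 - s (N div m))\<bar>
      \<le> 2 / real N * inverse (real m)" .
  qed
  also have "\<dots> = 2 * harm N / real N"
    by (simp add: harm_def sum_distrib_left sum_divide_distrib)
  finally show ?thesis .
qed

section \<open>The constants\<close>

lemma zeta_series_2: "zeta_series 2 = pi\<^sup>2 / 6"
  using sums_unique[OF inverse_squares_sums] by (simp add: zeta_series_def add.commute)

text \<open>\<open>L(1, \<chi>\<^sub>-\<^sub>3)\<close> is the integral of \<open>1 / (1 + t + t\<^sup>2)\<close> over \<open>[0, 1]\<close>: below, \<open>F\<close> is an antiderivative of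
  that integrand and \<open>G N\<close> one of its truncation \<open>(1 - t ^ (3 * N)) / (1 + t + t\<^sup>2)\<close>.\<close>

lemma L_chi3_1: "L_chi3 1 = pi / (3 * sqrt 3)"
proof -
  define f where "f n = chi3 (Suc n) / real (Suc n)" for n
  define F where "F t = 2 / sqrt 3 * arctan ((2 * t + 1) / sqrt 3)" for t :: real
  define G where "G N t = (\<Sum>k<N. t ^ (3 * k + 1) / real (3 * k + 1) - t ^ (3 * k + 2) / real (3 * k + 2))"
    for N and t :: real
  \<comment> \<open>Completing the square, 1 + t + t^2 = (t + 1/2)^2 + 3/4, whence the arctangent in
    \<open>F\<close>.\<close>
  have F': "(F has_real_derivative 1 / (1 + t + t\<^sup>2)) (at t within A)" for t A
  proof -
    have "((\<lambda>t. (2 * t + 1) / sqrt 3) has_real_derivative 2 / sqrt 3) (at t within A)"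
      by (auto intro!: derivative_eq_intros simp: field_simps)
    from DERIV_cmult[OF DERIV_chain2[OF DERIV_arctan this], of "2 / sqrt 3"]
    have "(F has_real_derivative 2 / sqrt 3 * (inverse (1 + ((2 * t + 1) / sqrt 3)\<^sup>2) * (2 / sqrt 3)))
        (at t within A)"
      unfolding F_def .
    moreover have "2 / sqrt 3 * (inverse z * (2 / sqrt 3)) = 4 / 3 / z" for z
    proof -
      have "2 / sqrt 3 * (inverse z * (2 / sqrt 3)) = (2 / sqrt 3 * (2 / sqrt 3)) / z"
        by (simp only: divide_inverse mult_ac)
      then show ?thesis by simp
    qed
    moreover have "1 + ((2 * t + 1) / sqrt 3)\<^sup>2 = 4 / 3 * (1 + t + t\<^sup>2)"
      by (simp add: power_divide field_simps power2_eq_square)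
    ultimately have "(F has_real_derivative 4 / 3 / (4 / 3 * (1 + t + t\<^sup>2))) (at t within A)"
      by (simp only:)
    then show ?thesis by (simp only: divide_divide_eq_left[symmetric]) simp
  qed
  have F1: "F 1 - F 0 = pi / (3 * sqrt 3)"
  proof -
    have arctan: "arctan (1 / sqrt 3) = pi / 6" "arctan (sqrt 3) = pi / 3"
      using arctan_unique[of "pi/6"] arctan_unique[of "pi/3"] by (simp_all add: tan_30 tan_60)
    have "3 / sqrt 3 = sqrt 3" by (rule real_div_sqrt) simp
    moreover have "F 1 = 2 / sqrt 3 * arctan (3 / sqrt 3)" "F 0 = 2 / sqrt 3 * arctan (1 / sqrt 3)"
      by (simp_all add: F_def)
    ultimately have "F 1 - F 0 = 2 / sqrt 3 * (pi / 3) - 2 / sqrt 3 * (pi / 6)"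
      by (simp only: arctan)
    then show ?thesis by (simp add: field_simps)
  qed
  have pow': "((\<lambda>t. t ^ Suc n / real (Suc n)) has_real_derivative t ^ n) (at t within A)"
    for n A and t :: real
    by (rule DERIV_cong[OF DERIV_cdivide[OF DERIV_power_Suc[OF DERIV_ident]]]) simp
  have G': "(G N has_real_derivative (\<Sum>k<N. t ^ (3 * k) - t ^ (3 * k + 1))) (at t within A)" for N t A
    unfolding G_def using pow'[of "3 * k" t A for k] pow'[of "3 * k + 1" t A for k]
    by (intro DERIV_sum DERIV_diff) simp_all
  have pos: "1 + t + t\<^sup>2 \<ge> 1" if "t \<ge> 0" for t :: real using that by simp
  \<comment> \<open>Multiplication by 1 + t + t^2 turns each block t^(3k) - t^(3k+1) into t^(3k) -
    t^(3k+3), so the sum telescopes.\<close>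
  have geom: "(\<Sum>k<N. t ^ (3 * k) - t ^ (3 * k + 1)) = (1 - t ^ (3 * N)) / (1 + t + t\<^sup>2)"
    if "t \<ge> 0" for N and t :: real
  proof -
    have "(1 + t + t\<^sup>2) * (\<Sum>k<N. t ^ (3 * k) - t ^ (3 * k + 1)) = 1 - t ^ (3 * N)"
      by (induction N) (simp_all add: algebra_simps power_add power2_eq_square power3_eq_cube)
    then show ?thesis using pos[OF that] by (simp add: field_simps)
  qed
  \<comment> \<open>The derivatives of \<open>F\<close> and \<open>G N\<close> differ by t^(3N)/(1 +
    t + t^2), which lies between 0 and t^(3N) on [0, 1]. Monotonicity of suitable differences
    replaces integration; the upper bound adds the integral 1/(3N + 1) of t^(3N).\<close>
  have lower: "G N 1 \<le> F 1 - F 0" for N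
  proof -
    have "F 0 - G N 0 \<le> F 1 - G N 1"
    proof (rule DERIV_nonneg_imp_nondecreasing[of 0 1 "\<lambda>t. F t - G N t"])
      fix t :: real assume t: "0 \<le> t" "t \<le> 1"
      have "((\<lambda>t. F t - G N t) has_real_derivative t ^ (3 * N) / (1 + t + t\<^sup>2)) (at t)"
        by (rule DERIV_cong[OF DERIV_diff[OF F' G']])
          (simp only: geom[OF t(1)] diff_divide_distrib diff_diff_eq2 add_diff_cancel_left')
      moreover have "t ^ (3 * N) / (1 + t + t\<^sup>2) \<ge> 0" using t by simp
      ultimately show "\<exists>y. ((\<lambda>t. F t - G N t) has_real_derivative y) (at t) \<and> 0 \<le> y" by blast
    qed simp
    then show ?thesis by (simp add: G_def)
  qed
  have upper: "F 1 - F 0 \<le> G N 1 + 1 / real (3 * N + 1)" for N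
  proof -
    define H where "H t = G N t + t ^ (3 * N + 1) / real (3 * N + 1) - F t" for t
    have "H 0 \<le> H 1"
    proof (rule DERIV_nonneg_imp_nondecreasing[of 0 1 H])
      fix t :: real assume t: "0 \<le> t" "t \<le> 1"
      have "((\<lambda>t. t ^ (3 * N + 1) / real (3 * N + 1)) has_real_derivative t ^ (3 * N)) (at t)"
        using pow'[of "3 * N"] by simp
      then have "(H has_real_derivative t ^ (3 * N) * (1 - 1 / (1 + t + t\<^sup>2))) (at t)"
        unfolding H_def
        by (rule DERIV_cong[OF DERIV_diff[OF DERIV_add[OF G'] F']])
          (simp only: geom[OF t(1)], simp add: diff_divide_distrib right_diff_distrib)
      moreover have "t ^ (3 * N) * (1 - 1 / (1 + t + t\<^sup>2)) \<ge> 0"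
        using t pos[of t] by (intro mult_nonneg_nonneg) (simp_all add: divide_le_eq)
      ultimately show "\<exists>y. (H has_real_derivative y) (at t) \<and> 0 \<le> y" by blast
    qed simp
    then show ?thesis by (simp add: H_def G_def)
  qed
  \<comment> \<open>Index k of \<open>f\<close> belongs to the integer k + 1, so the block starting
    at 3q has residues 1, 2, 0 and coefficients 1, -1, 0.\<close>
  have f3: "f (3 * q) = 1 / real (3 * q + 1)" "f (Suc (3 * q)) = - (1 / real (3 * q + 2))"
    "f (Suc (Suc (3 * q))) = 0" for q
  proof -
    have "Suc (3 * q) mod 3 = 1" "Suc (Suc (3 * q)) mod 3 = 2" "Suc (Suc (Suc (3 * q))) mod 3 = 0"
      by presburger+
    then show "f (3 * q) = 1 / real (3 * q + 1)" "f (Suc (3 * q)) = - (1 / real (3 * q + 2))"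
      "f (Suc (Suc (3 * q))) = 0"
      by (simp_all add: f_def chi3_def add.commute)
  qed
  have S3: "(\<Sum>k<3 * q. f k) = G q 1" for q
  proof (induction q)
    case (Suc q)
    have "3 * Suc q = Suc (Suc (Suc (3 * q)))" by simp
    then have "(\<Sum>k<3 * Suc q. f k) = G q 1 + f (3 * q) + f (Suc (3 * q)) + f (Suc (Suc (3 * q)))"
      by (simp only: sum.lessThan_Suc Suc.IH)
    also have "\<dots> = G (Suc q) 1" by (simp add: f3 G_def)
    finally show ?case .
  qed (simp add: G_def)
  have bound: "\<bar>(\<Sum>k<n. f k) - pi / (3 * sqrt 3)\<bar> \<le> 3 / real (Suc n)" for n
  proof -
    define q where "q = n div 3"
    have q: "1 / real (3 * q + 2) \<le> 1 / real (3 * q + 1)"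
      by (simp add: frac_le)
    have "n = 3 * q \<or> n = Suc (3 * q) \<or> n = Suc (Suc (3 * q))"
      unfolding q_def by presburger
    \<comment> \<open>Wherever in a block the sum is cut, it lies with the limit in one interval of
      length 1/(3q + 1); this gives convergence along all n and not only along multiples of
      3.\<close>
    then have "G q 1 \<le> (\<Sum>k<n. f k)" "(\<Sum>k<n. f k) \<le> G q 1 + 1 / real (3 * q + 1)"
      using q by (auto simp: S3 f3)
    then have "\<bar>(\<Sum>k<n. f k) - pi / (3 * sqrt 3)\<bar> \<le> 1 / real (3 * q + 1)"
      using lower[of q] upper[of q] unfolding F1 by linarith
    also have "\<dots> = 3 / real (3 * (3 * q + 1))" by (simp add: field_simps)
    also have "\<dots> \<le> 3 / real (Suc n)"
    proof (intro divide_left_mono mult_pos_pos)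
      have "Suc n \<le> 3 * (3 * q + 1)" unfolding q_def by presburger
      then show "real (Suc n) \<le> real (3 * (3 * q + 1))" by (simp only: of_nat_le_iff)
    qed auto
    finally show ?thesis .
  qed
  have "(\<lambda>n. (\<Sum>k<n. f k) - pi / (3 * sqrt 3)) \<longlonglongrightarrow> 0"
    by (rule Lim_null_comparison[OF _ LIMSEQ_Suc[OF lim_const_over_n[of 3]]])
      (use bound in \<open>auto simp del: of_nat_Suc\<close>)
  then have "f sums (pi / (3 * sqrt 3))"
    unfolding sums_def by (simp add: LIM_zero_iff)
  then have "suminf f = pi / (3 * sqrt 3)" by (rule sums_unique[symmetric])
  then show ?thesis by (simp add: L_chi3_def f_def[abs_def] del: of_nat_Suc)
qed

section \<open>Similar sublattices as principal ideals\<close>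

definition hex_point :: "int \<Rightarrow> int \<Rightarrow> complex" where
  "hex_point a b = of_int a + of_int b * \<rho>"

definition hex_norm :: "int \<Rightarrow> int \<Rightarrow> int" where
  "hex_norm a b = a\<^sup>2 + a * b + b\<^sup>2"

lemma Re_hex_point [simp]: "Re (hex_point a b) = of_int a + of_int b / 2"
  and Im_hex_point [simp]: "Im (hex_point a b) = of_int b * sqrt 3 / 2"
  by (simp_all add: hex_point_def \<rho>_def)

lemma hex_point_eq_iff [simp]: "hex_point a b = hex_point c d \<longleftrightarrow> a = c \<and> b = d"
  by (auto simp: complex_eq_iff)

lemma hex_point_0_0 [simp]: "hex_point 0 0 = 0"
  and hex_point_1_0 [simp]: "hex_point 1 0 = 1"
  by (simp_all add: hex_point_def)

lemma hex_point_eq_0_iff [simp]: "hex_point a b = 0 \<longleftrightarrow> a = 0 \<and> b = 0"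
  using hex_point_eq_iff[of a b 0 0] by (simp del: hex_point_eq_iff)

lemma hex_point_diff: "hex_point a b - hex_point c d = hex_point (a - c) (b - d)"
  and of_int_mult_hex_point: "of_int m * hex_point a b = hex_point (m * a) (m * b)"
  by (simp_all add: hex_point_def algebra_simps)

lemma hex_point_mult:
  "hex_point a b * hex_point c d = hex_point (a * c - b * d) (a * d + b * c + b * d)"
  by (simp add: complex_eq_iff field_simps)

lemma cnj_hex_point: "cnj (hex_point a b) = hex_point (a + b) (- b)"
  by (simp add: complex_eq_iff)

lemma cmod_hex_point: "(cmod (hex_point a b))\<^sup>2 = of_int (hex_norm a b)"
  unfolding cmod_power2 by (simp add: hex_norm_def power2_eq_square field_simps)

text \<open>Completing the square in either variable; positive definiteness and the coordinate
  bounds both come from here.\<close>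

lemma four_hex_norm: "4 * hex_norm a b = (2 * a + b)\<^sup>2 + 3 * b\<^sup>2"
  "4 * hex_norm a b = (2 * b + a)\<^sup>2 + 3 * a\<^sup>2"
  by (simp_all add: hex_norm_def power2_eq_square algebra_simps)

lemma hex_norm_nonneg [simp]: "hex_norm a b \<ge> 0"
  using four_hex_norm[of a b] by (smt (verit) zero_le_power2)

lemma hex_norm_eq_0_iff [simp]: "hex_norm a b = 0 \<longleftrightarrow> a = 0 \<and> b = 0"
proof
  assume "hex_norm a b = 0"
  then have "3 * b\<^sup>2 \<le> 0" "3 * a\<^sup>2 \<le> 0"
    using four_hex_norm[of a b] zero_le_power2[of "2 * a + b"] zero_le_power2[of "2 * b + a"] by linarith+
  then show "a = 0 \<and> b = 0" by simp
qed (simp add: hex_norm_def)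

lemma hex_norm_0_0 [simp]: "hex_norm 0 0 = 0"
  by simp

lemma hex_norm_pos: "(a, b) \<noteq> (0, 0) \<Longrightarrow> hex_norm a b > 0"
  using hex_norm_nonneg[of a b] hex_norm_eq_0_iff[of a b] by (simp add: less_le)

lemma hex_norm_mult_left: "hex_norm (m * a) (m * b) = m\<^sup>2 * hex_norm a b"
  by (simp add: hex_norm_def power2_eq_square algebra_simps)

lemma abs_int_le_square: "\<bar>a :: int\<bar> \<le> a\<^sup>2"
  using self_le_power[of "\<bar>a\<bar>" 2] by (cases "a = 0") auto

text \<open>From 3a^2 \<le> 4N and |a| \<le> a^2, with the factor 4/3 rounded up to 2. The bound
  confines points of bounded norm to a finite box.\<close>

lemma abs_le_hex_norm: "\<bar>a\<bar> \<le> 2 * hex_norm a b" "\<bar>b\<bar> \<le> 2 * hex_norm a b"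
  using four_hex_norm[of a b] zero_le_power2[of "2 * a + b"] zero_le_power2[of "2 * b + a"]
    abs_int_le_square[of a] abs_int_le_square[of b] hex_norm_nonneg[of a b] by linarith+

lemma finite_hex_norm_le: "finite {(a, b). real_of_int (hex_norm a b) \<le> x}"
proof (rule finite_subset)
  let ?I = "{- 2 * \<lfloor>x\<rfloor>..2 * \<lfloor>x\<rfloor>}"
  show "{(a, b). real_of_int (hex_norm a b) \<le> x} \<subseteq> ?I \<times> ?I"
  proof clarsimp
    fix a b assume "real_of_int (hex_norm a b) \<le> x"
    then have "hex_norm a b \<le> \<lfloor>x\<rfloor>" by (simp add: le_floor_iff)
    then show "- (2 * \<lfloor>x\<rfloor>) \<le> a \<and> a \<le> 2 * \<lfloor>x\<rfloor> \<and> - (2 * \<lfloor>x\<rfloor>) \<le> b \<and> b \<le> 2 * \<lfloor>x\<rfloor>"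
      using abs_le_hex_norm(1)[of a b] abs_le_hex_norm(2)[of b a] by linarith
  qed
qed auto

lemma hexagonal_lattice_eq: "hexagonal_lattice = {hex_point a b | a b. True}"
  by (simp add: hexagonal_lattice_def hex_point_def)

lemma hex_point_in_lattice [simp]: "hex_point a b \<in> hexagonal_lattice"
  by (auto simp: hexagonal_lattice_eq)

lemma hexagonal_latticeE:
  assumes "z \<in> hexagonal_lattice" obtains a b where "z = hex_point a b"
  using assms by (auto simp: hexagonal_lattice_eq)

lemma one_in_hexagonal_lattice [simp]: "1 \<in> hexagonal_lattice"
  using hex_point_in_lattice[of 1 0] by (simp del: hex_point_in_lattice)

lemma hexagonal_lattice_mult:
  "z \<in> hexagonal_lattice \<Longrightarrow> w \<in> hexagonal_lattice \<Longrightarrow> z * w \<in> hexagonal_lattice"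
  by (auto elim!: hexagonal_latticeE simp: hex_point_mult)

lemma cnj_in_hexagonal_lattice_iff [simp]: "cnj z \<in> hexagonal_lattice \<longleftrightarrow> z \<in> hexagonal_lattice"
proof -
  have "cnj z \<in> hexagonal_lattice" if "z \<in> hexagonal_lattice" for z
    using that by (auto elim!: hexagonal_latticeE simp: cnj_hex_point)
  from this[of z] this[of "cnj z"] show ?thesis by auto
qed

lemma cnj_image_hexagonal_lattice: "cnj ` hexagonal_lattice = hexagonal_lattice"
proof
  show "hexagonal_lattice \<subseteq> cnj ` hexagonal_lattice"
  proof
    fix z assume "z \<in> hexagonal_lattice"
    then have "cnj z \<in> hexagonal_lattice" "z = cnj (cnj z)" by simp_all
    then show "z \<in> cnj ` hexagonal_lattice" by blast
  qed
qed auto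

section \<open>Plane isometries, and similar sublattices as ideals\<close>

lemma orthogonal_transformation_complex:
  assumes "orthogonal_transformation (R :: complex \<Rightarrow> complex)"
  obtains u where "cmod u = 1" "R = (\<lambda>z. u * z) \<or> R = (\<lambda>z. u * cnj z)"
proof -
  have lin: "linear R" and norm: "cmod (R z) = cmod z" for z
    using assms by (auto simp: orthogonal_transformation)
  \<comment> \<open>Dividing by the image of 1 reduces to maps that fix 1. The image v of the
    imaginary unit then has modulus 1 and |1 + v|^2 = 2, which forces Re v = 0: a rotation or a
    reflection.\<close>
  define u where "u = R 1"
  define v where "v = R \<i> / u"
  have u: "cmod u = 1" "u \<noteq> 0" using norm[of 1] by (auto simp: u_def)
  have v: "cmod v = 1" using norm[of \<i>] u by (simp add: v_def norm_divide)
  have "R (1 + \<i>) = u * (1 + v)"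
    using linear_add[OF lin, of 1 \<i>] u by (simp add: u_def v_def algebra_simps)
  then have "cmod (1 + v) = cmod (1 + \<i>)" using norm[of "1 + \<i>"] u by (simp add: norm_mult)
  then have "(cmod (1 + v))\<^sup>2 = 2" by (simp add: cmod_power2)
  then have "(Re v)\<^sup>2 + (Im v)\<^sup>2 = 1 \<and> (1 + Re v)\<^sup>2 + (Im v)\<^sup>2 = 2"
    using v cmod_power2[of v] cmod_power2[of "1 + v"] by simp
  then have "Re v = 0" by (simp add: power2_eq_square algebra_simps)
  moreover from this have "Im v = 1 \<or> Im v = -1"
    using v cmod_power2[of v] by (simp add: power2_eq_1_iff)
  ultimately have v_cases: "v = \<i> \<or> v = - \<i>" by (auto simp: complex_eq_iff)
  have R: "R z = u * (of_real (Re z) + of_real (Im z) * v)" for z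
  proof -
    have "R z = R (Re z *\<^sub>R 1 + Im z *\<^sub>R \<i>)"
      by (rule arg_cong[of _ _ R]) (simp add: complex_eq_iff)
    also have "\<dots> = Re z *\<^sub>R u + Im z *\<^sub>R (u * v)"
      using u by (simp add: linear_add[OF lin] linear_scale[OF lin] u_def v_def)
    finally show ?thesis by (simp add: scaleR_conv_of_real algebra_simps)
  qed
  have "R = (\<lambda>z. u * z)" if "v = \<i>"
    by (rule ext, subst R, unfold that) (simp add: complex_eq_iff)
  moreover have "R = (\<lambda>z. u * cnj z)" if "v = - \<i>"
    by (rule ext, subst R, unfold that) (simp add: complex_eq_iff)
  ultimately show ?thesis using v_cases u(1) that by blast
qed

text \<open>The generator lies in the lattice because it is the image of 1. Conversely,
  multiplication by \<open>c\<close> is the rotation by \<open>sgn c\<close> followed by the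
  dilation by \<open>cmod c\<close>, and closure under products keeps the image inside.\<close>

lemma similar_sublattice_hexagonal_iff:
  "similar_sublattice hexagonal_lattice \<Lambda> \<longleftrightarrow>
     (\<exists>c\<in>hexagonal_lattice. c \<noteq> 0 \<and> \<Lambda> = (\<lambda>z. c * z) ` hexagonal_lattice)"
proof
  assume "similar_sublattice hexagonal_lattice \<Lambda>"
  then obtain \<alpha> R where \<alpha>: "\<alpha> > 0" and R: "orthogonal_transformation R"
    and \<Lambda>: "\<Lambda> = (\<lambda>z. \<alpha> *\<^sub>R R z) ` hexagonal_lattice" "\<Lambda> \<subseteq> hexagonal_lattice"
    unfolding similar_sublattice_def by blast
  from R obtain u where u: "cmod u = 1" "R = (\<lambda>z. u * z) \<or> R = (\<lambda>z. u * cnj z)"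
    by (rule orthogonal_transformation_complex)
  define c where "c = of_real \<alpha> * u"
  have c: "\<Lambda> = (\<lambda>z. c * z) ` hexagonal_lattice"
    using u(2)
  proof
    assume "R = (\<lambda>z. u * cnj z)"
    then have "\<Lambda> = (\<lambda>z. c * z) ` cnj ` hexagonal_lattice"
      unfolding \<Lambda>(1) image_image by (simp add: c_def scaleR_conv_of_real mult.assoc)
    then show ?thesis by (simp add: cnj_image_hexagonal_lattice)
  qed (simp add: \<Lambda>(1) c_def scaleR_conv_of_real mult.assoc)
  have "c \<in> \<Lambda>" unfolding c by (rule image_eqI[of _ _ 1]) auto
  moreover have "c \<noteq> 0" using \<alpha> u(1) by (auto simp: c_def)
  ultimately show "\<exists>c\<in>hexagonal_lattice. c \<noteq> 0 \<and> \<Lambda> = (\<lambda>z. c * z) ` hexagonal_lattice"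
    using \<Lambda>(2) c by blast
next
  assume "\<exists>c\<in>hexagonal_lattice. c \<noteq> 0 \<and> \<Lambda> = (\<lambda>z. c * z) ` hexagonal_lattice"
  then obtain c where c: "c \<in> hexagonal_lattice" "c \<noteq> 0" "\<Lambda> = (\<lambda>z. c * z) ` hexagonal_lattice"
    by blast
  define R where "R = (\<lambda>z. sgn c * z)"
  have "linear R" unfolding R_def by (intro bounded_linear.linear bounded_linear_mult_right)
  moreover have "cmod (R z) = cmod z" for z using c(2) by (simp add: R_def norm_mult norm_sgn)
  ultimately have "orthogonal_transformation R" by (simp add: orthogonal_transformation)
  moreover have "cmod c *\<^sub>R R z = c * z" for z
    using c(2) by (simp add: R_def sgn_eq scaleR_conv_of_real)
  moreover have "\<Lambda> \<subseteq> hexagonal_lattice" using c hexagonal_lattice_mult by auto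
  ultimately show "similar_sublattice hexagonal_lattice \<Lambda>"
    unfolding similar_sublattice_def using c(2,3)
    by (intro exI[of _ "cmod c"] exI[of _ R]) auto
qed

section \<open>Index of a principal ideal\<close>

lemma hex_point_in_principal_iff:
  "hex_point x y \<in> (\<lambda>z. hex_point a b * z) ` hexagonal_lattice \<longleftrightarrow>
     (\<exists>p q. x = a * p - b * q \<and> y = a * q + b * p + b * q)"
proof -
  have "hex_point x y \<in> (\<lambda>z. hex_point a b * z) ` hexagonal_lattice \<longleftrightarrow>
      (\<exists>p q. hex_point x y = hex_point a b * hex_point p q)"
    by (auto simp: hexagonal_lattice_eq image_iff simp del: mult_cancel_left)
  then show ?thesis by (simp add: hex_point_mult)
qed

text \<open>Hermite normal form: with \<open>g = gcd a b\<close>, the sublattice \<open>(a + b\<rho>)\<Gamma>\<close> is spanned by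
  \<open>N / g\<close> and an element of the form \<open>t + g\<rho>\<close>, so the points \<open>x + y\<rho>\<close> with
  \<open>0 \<le> x < N / g\<close>, \<open>0 \<le> y < g\<close> are coset representatives.\<close>

lemma lattice_index_principal:
  assumes "(a, b) \<noteq> (0, 0)"
  shows "lattice_index hexagonal_lattice ((\<lambda>z. hex_point a b * z) ` hexagonal_lattice)
      = nat (hex_norm a b)"
proof -
  define \<Lambda> where "\<Lambda> = (\<lambda>z. hex_point a b * z) ` hexagonal_lattice"
  define r where "r = {(x, y). x \<in> hexagonal_lattice \<and> y \<in> hexagonal_lattice \<and> x - y \<in> \<Lambda>}"
  define g where "g = gcd a b"
  have g: "g > 0" using assms by (auto simp: g_def)
  obtain a' b' where ab: "a = g * a'" "b = g * b'"
    by (metis dvdE gcd_dvd1 gcd_dvd2 g_def)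
  have cop: "coprime a' b'"
    using gcd_mult_distrib_int[of g a' b'] g unfolding g_def[symmetric] ab[symmetric]
    by (auto simp: coprime_iff_gcd_eq_1 g_def[symmetric])
  \<comment> \<open>This is the N / g of the normal form without division: the norm of a + b rho is
    g^2 times that of a' + b' rho.\<close>
  define h where "h = g * hex_norm a' b'"
  have N: "hex_norm a b = h * g"
    by (simp add: ab hex_norm_mult_left h_def power2_eq_square)
  have h: "h > 0" using hex_norm_pos[OF assms] g by (simp add: N zero_less_mult_iff)
  obtain s t where st: "s * a' + t * b' = 1"
    using cop by (metis bezout_int coprime_iff_gcd_eq_1)
  have mem: "hex_point x y \<in> \<Lambda> \<longleftrightarrow> (\<exists>p q. x = a * p - b * q \<and> y = a * q + b * p + b * q)" for x y
    unfolding \<Lambda>_def by (rule hex_point_in_principal_iff)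
  have add_mem: "hex_point (x + x') (y + y') \<in> \<Lambda>"
    if xy: "hex_point x y \<in> \<Lambda>" "hex_point x' y' \<in> \<Lambda>" for x y x' y'
  proof -
    from xy obtain p q p' q' where eq: "x = a * p - b * q" "y = a * q + b * p + b * q"
      "x' = a * p' - b * q'" "y' = a * q' + b * p' + b * q'" unfolding mem by blast
    have "x + x' = a * (p + p') - b * (q + q')"
      "y + y' = a * (q + q') + b * (p + p') + b * (q + q')"
      unfolding eq by (simp_all add: algebra_simps)
    then show ?thesis unfolding mem by blast
  qed
  have mult_mem: "hex_point (k * x) (k * y) \<in> \<Lambda>" if xy: "hex_point x y \<in> \<Lambda>" for x y k
  proof -
    from xy obtain p q where eq: "x = a * p - b * q" "y = a * q + b * p + b * q"
      unfolding mem by blast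
    have "k * x = a * (k * p) - b * (k * q)" "k * y = a * (k * q) + b * (k * p) + b * (k * q)"
      unfolding eq by (simp_all add: algebra_simps)
    then show ?thesis unfolding mem by blast
  qed
  \<comment> \<open>The multiplier (a' + b') - b' rho is the conjugate of a' + b' rho, so the
    product is g times the norm of a' + b' rho.\<close>
  have h_mem: "hex_point h 0 \<in> \<Lambda>"
    unfolding mem by (rule exI[of _ "a' + b'"], rule exI[of _ "- b'"])
      (simp add: h_def hex_norm_def ab power2_eq_square algebra_simps)
  \<comment> \<open>The rho-coordinate of a product is a q + b (p + q); the Bezout choice q = s, p +
    q = t makes it g.\<close>
  have g_mem: "hex_point (a * (t - s) - b * s) g \<in> \<Lambda>"
  proof -
    have "g = g * (s * a' + t * b')" using st by simp
    then have "g = a * s + b * (t - s) + b * s" by (simp add: ab algebra_simps)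
    then show ?thesis unfolding mem by blast
  qed
  have y_dvd: "g dvd y" if "hex_point x y \<in> \<Lambda>" for x y
    using that unfolding mem by (auto simp: ab)
  \<comment> \<open>A vanishing rho-coordinate means a' q = -b' (p + q). Coprimality gives q = b' k,
    and cancelling b' shows that the multiplier is -k times the conjugate used for
    \<open>h_mem\<close>. For b' = 0 nothing can be cancelled, but then a' is 1 or -1 and h =
    g.\<close>
  have x_dvd: "h dvd x" if "hex_point x 0 \<in> \<Lambda>" for x
  proof -
    from that obtain p q where x: "x = a * p - b * q" and "0 = a * q + b * p + b * q"
      unfolding mem by blast
    then have "g * (a' * q + b' * (p + q)) = 0" by (simp add: ab algebra_simps)
    then have eq: "a' * q = - (b' * (p + q))" using g by auto
    then have "b' dvd a' * q" by simp
    then have "b' dvd q" using cop by (simp add: coprime_dvd_mult_right_iff coprime_commute)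
    then obtain k where k: "q = b' * k" by auto
    show ?thesis
    proof (cases "b' = 0")
      case True
      then have "\<bar>a'\<bar> = 1" using cop by simp
      then have "hex_norm a' b' = 1" using True by (simp add: hex_norm_def power2_eq_1_iff) linarith
      then show ?thesis using True by (simp add: h_def x ab)
    next
      case False
      have "b' * (a' * k) = b' * (- (p + q))" using eq k by (simp add: algebra_simps)
      then have "a' * k = - (p + q)" using False by (simp only: mult_cancel_left) simp
      then have p: "p = - (a' + b') * k" using k by (simp add: algebra_simps)
      have "x = h * (- k)"
        unfolding x k p h_def hex_norm_def ab by (simp add: power2_eq_square algebra_simps)
      then show ?thesis by simp
    qed
  qed
  have refl_mem: "0 \<in> \<Lambda>" using mult_mem[OF h_mem, of 0] by simp
  have equiv: "equiv hexagonal_lattice r"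
  proof (rule equivI)
    show "r \<subseteq> hexagonal_lattice \<times> hexagonal_lattice" by (auto simp: r_def)
    show "refl_on hexagonal_lattice r" using refl_mem by (auto simp: refl_on_def r_def)
    show "sym r"
    proof (rule symI)
      fix z w assume zw: "(z, w) \<in> r"
      then obtain x y x' y' where "z = hex_point x y" "w = hex_point x' y'"
        by (auto simp: r_def elim!: hexagonal_latticeE)
      then show "(w, z) \<in> r"
        using zw mult_mem[of "x - x'" "y - y'" "-1"] by (simp add: r_def hex_point_diff)
    qed
    show "trans r"
    proof (rule transI)
      fix u v w assume uvw: "(u, v) \<in> r" "(v, w) \<in> r"
      then obtain x y x' y' x'' y''
        where "u = hex_point x y" "v = hex_point x' y'" "w = hex_point x'' y''"
        by (auto simp: r_def elim!: hexagonal_latticeE)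
      then show "(u, w) \<in> r"
        using uvw add_mem[of "x - x'" "y - y'" "x' - x''" "y' - y''"]
        by (simp add: r_def hex_point_diff)
    qed
  qed
  define D where "D = {0..<h} \<times> {0..<g}"
  define f where "f = (\<lambda>(x, y). r `` {hex_point x y})"
  have rel: "(hex_point x y, hex_point x' y') \<in> r \<longleftrightarrow> hex_point (x - x') (y - y') \<in> \<Lambda>" for x y x' y'
    by (simp add: r_def hex_point_diff)
  have "bij_betw f D (hexagonal_lattice // r)"
  proof (rule bij_betw_imageI)
    show "inj_on f D"
    proof (rule inj_onI, clarify)
      fix x y x' y' assume D: "(x, y) \<in> D" "(x', y') \<in> D" and "f (x, y) = f (x', y')"
      then have "(hex_point x y, hex_point x' y') \<in> r"
        using eq_equiv_class[OF _ equiv, of "hex_point x y" "hex_point x' y'"] by (simp add: f_def)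
      then have m: "hex_point (x - x') (y - y') \<in> \<Lambda>" by (simp add: rel)
      have "\<bar>y - y'\<bar> < g" using D by (auto simp: D_def)
      then have y: "y = y'" using y_dvd[OF m] dvd_imp_le_int[of "y - y'" g] by fastforce
      have "\<bar>x - x'\<bar> < h" using D by (auto simp: D_def)
      then show "x = x' \<and> y = y'" using x_dvd[of "x - x'"] m y dvd_imp_le_int[of "x - x'" h] by fastforce
    qed
    show "f ` D = hexagonal_lattice // r"
    proof
      show "f ` D \<subseteq> hexagonal_lattice // r" by (auto simp: f_def intro: quotientI)
      show "hexagonal_lattice // r \<subseteq> f ` D"
      proof
        fix C assume "C \<in> hexagonal_lattice // r"
        then obtain x y where C: "C = r `` {hex_point x y}"
          by (auto elim!: quotientE hexagonal_latticeE)
        \<comment> \<open>The rho-coordinate is reduced modulo g by subtracting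
          \<open>y div g\<close> copies of the element in \<open>g_mem\<close>; \<open>x1\<close> is
          the first coordinate left over, still to be reduced modulo h.\<close>
        define x1 where "x1 = x - (y div g) * (a * (t - s) - b * s)"
        have "hex_point ((y div g) * (a * (t - s) - b * s) + (x1 div h) * h) ((y div g) * g + (x1 div h) * 0) \<in> \<Lambda>"
          by (intro add_mem mult_mem g_mem h_mem)
        moreover have "(y div g) * (a * (t - s) - b * s) + (x1 div h) * h = x - x1 mod h"
          by (simp add: x1_def minus_mult_div_eq_mod[symmetric] algebra_simps)
        moreover have "(y div g) * g + (x1 div h) * 0 = y - y mod g"
          by (simp add: minus_mod_eq_div_mult)
        ultimately have "(hex_point x y, hex_point (x1 mod h) (y mod g)) \<in> r"
          by (simp add: rel)
        then have "C = f (x1 mod h, y mod g)"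
          unfolding C f_def using equiv_class_eq[OF equiv] by simp
        moreover have "(x1 mod h, y mod g) \<in> D" using g h by (simp add: D_def)
        ultimately show "C \<in> f ` D" by blast
      qed
    qed
  qed
  then have "card (hexagonal_lattice // r) = card D" by (simp add: bij_betw_same_card)
  also have "\<dots> = nat (hex_norm a b)" using g h by (simp add: D_def N nat_mult_distrib)
  finally show ?thesis by (simp add: lattice_index_def r_def \<Lambda>_def)
qed

section \<open>Units, generators and primitivity\<close>

lemma hex_norm_eq_1_iff:
  "hex_norm a b = 1 \<longleftrightarrow> (a, b) \<in> {(1, 0), (-1, 0), (0, 1), (0, -1), (1, -1), (-1, 1)}"
proof
  assume N: "hex_norm a b = 1"
  then have "\<bar>a\<bar> \<le> 2" "\<bar>b\<bar> \<le> 2"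
    using abs_le_hex_norm(1)[of a b] abs_le_hex_norm(2)[of b a] by simp_all
  then have "a = -2 \<or> a = -1 \<or> a = 0 \<or> a = 1 \<or> a = 2" "b = -2 \<or> b = -1 \<or> b = 0 \<or> b = 1 \<or> b = 2"
    by linarith+
  then show "(a, b) \<in> {(1, 0), (-1, 0), (0, 1), (0, -1), (1, -1), (-1, 1)}"
    using N unfolding hex_norm_def by (elim disjE) simp_all
qed (auto simp: hex_norm_def)

lemma card_hexagonal_units: "card {u \<in> hexagonal_lattice. cmod u = 1} = 6"
proof -
  define U :: "(int \<times> int) set" where "U = {(1, 0), (-1, 0), (0, 1), (0, -1), (1, -1), (-1, 1)}"
  have "cmod (hex_point a b) = 1 \<longleftrightarrow> hex_norm a b = 1" for a b
    using cmod_hex_point[of a b] by (smt (verit) norm_ge_zero of_int_eq_1_iff one_power2 power2_eq_imp_eq)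
  then have "cmod (hex_point a b) = 1 \<longleftrightarrow> (a, b) \<in> U" for a b
    by (simp only: hex_norm_eq_1_iff U_def)
  then have "{u \<in> hexagonal_lattice. cmod u = 1} = (\<lambda>(a, b). hex_point a b) ` U"
    by (auto simp: hexagonal_lattice_eq image_iff)
  moreover have "inj_on (\<lambda>(a, b). hex_point a b) U" by (auto simp: inj_on_def)
  ultimately have "card {u \<in> hexagonal_lattice. cmod u = 1} = card U" by (simp add: card_image)
  then show ?thesis by (simp add: U_def)
qed

text \<open>Each generator lies in the ideal of the other, so they differ by a lattice factor, which
  equal moduli make unimodular. The inverse of such a factor is its conjugate, again a lattice
  point, so multiplication by it permutes the lattice.\<close>

lemma principal_eq_iff:
  assumes "c \<in> hexagonal_lattice" "d \<in> hexagonal_lattice" "c \<noteq> 0" "cmod c = cmod d"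
  shows "(\<lambda>z. d * z) ` hexagonal_lattice = (\<lambda>z. c * z) ` hexagonal_lattice \<longleftrightarrow>
    (\<exists>u\<in>hexagonal_lattice. cmod u = 1 \<and> d = c * u)"
proof
  assume "(\<lambda>z. d * z) ` hexagonal_lattice = (\<lambda>z. c * z) ` hexagonal_lattice"
  moreover have "d \<in> (\<lambda>z. d * z) ` hexagonal_lattice" by (rule image_eqI[of _ _ 1]) auto
  ultimately obtain u where "u \<in> hexagonal_lattice" "d = c * u" by auto
  moreover from this have "cmod u = 1" using assms(3,4) by (simp add: norm_mult)
  ultimately show "\<exists>u\<in>hexagonal_lattice. cmod u = 1 \<and> d = c * u" by blast
next
  assume "\<exists>u\<in>hexagonal_lattice. cmod u = 1 \<and> d = c * u"
  then obtain u where u: "u \<in> hexagonal_lattice" "cmod u = 1" "d = c * u" by blast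
  have inv: "u * cnj u = 1" using u(2) by (simp add: complex_norm_square[symmetric])
  have "(\<lambda>z. u * z) ` hexagonal_lattice = hexagonal_lattice"
  proof
    show "(\<lambda>z. u * z) ` hexagonal_lattice \<subseteq> hexagonal_lattice"
      using u(1) hexagonal_lattice_mult by auto
    show "hexagonal_lattice \<subseteq> (\<lambda>z. u * z) ` hexagonal_lattice"
    proof
      fix z assume "z \<in> hexagonal_lattice"
      then have "cnj u * z \<in> hexagonal_lattice" "z = u * (cnj u * z)"
        using u(1) hexagonal_lattice_mult inv by (simp_all add: mult.assoc[symmetric])
      then show "z \<in> (\<lambda>z. u * z) ` hexagonal_lattice" by blast
    qed
  qed
  then have "(\<lambda>z. c * z) ` (\<lambda>z. u * z) ` hexagonal_lattice = (\<lambda>z. c * z) ` hexagonal_lattice"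
    by simp
  then show "(\<lambda>z. d * z) ` hexagonal_lattice = (\<lambda>z. c * z) ` hexagonal_lattice"
    by (simp add: image_image u(3) mult.assoc)
qed

text \<open>The generator belongs to its own ideal, so if the ideal is m times a sublattice, m
  divides both coordinates. Conversely, the gcd of the coordinates can be pulled out of the
  generator, and it is at least 2 when they are not coprime.\<close>

lemma primitive_principal_iff:
  assumes "(a, b) \<noteq> (0, 0)"
  shows "primitive_similar_sublattice hexagonal_lattice ((\<lambda>z. hex_point a b * z) ` hexagonal_lattice)
    \<longleftrightarrow> coprime a b"
proof -
  let ?\<Lambda> = "(\<lambda>z. hex_point a b * z) ` hexagonal_lattice"
  have sim: "similar_sublattice hexagonal_lattice ?\<Lambda>"
    using assms unfolding similar_sublattice_hexagonal_iff by (intro bexI[of _ "hex_point a b"]) auto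
  have "(\<exists>m \<Lambda>'. m \<ge> 2 \<and> similar_sublattice hexagonal_lattice \<Lambda>' \<and>
      ?\<Lambda> = (\<lambda>z. of_int m *\<^sub>R z) ` \<Lambda>') \<longleftrightarrow> \<not> coprime a b"
  proof
    assume "\<exists>m \<Lambda>'. m \<ge> 2 \<and> similar_sublattice hexagonal_lattice \<Lambda>' \<and>
      ?\<Lambda> = (\<lambda>z. of_int m *\<^sub>R z) ` \<Lambda>'"
    then obtain m :: int and \<Lambda>' where m: "m \<ge> 2" "similar_sublattice hexagonal_lattice \<Lambda>'"
      "?\<Lambda> = (\<lambda>z. of_int m *\<^sub>R z) ` \<Lambda>'" by blast
    have "hex_point a b \<in> ?\<Lambda>" by (rule image_eqI[of _ _ 1]) auto
    then obtain z where z: "z \<in> \<Lambda>'" "hex_point a b = of_int m *\<^sub>R z" unfolding m(3) by blast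
    have "z \<in> hexagonal_lattice" using m(2) z(1) by (auto simp: similar_sublattice_def)
    then obtain c d where "z = hex_point c d" by (rule hexagonal_latticeE)
    then have "a = m * c" "b = m * d"
      using z(2) by (simp_all add: scaleR_conv_of_real of_int_mult_hex_point)
    then have "m dvd a" "m dvd b" by simp_all
    then show "\<not> coprime a b" using m(1) coprime_common_divisor_int[of a b m] by auto
  next
    assume ncop: "\<not> coprime a b"
    define m where "m = gcd a b"
    have m: "m \<ge> 2"
      using ncop assms gcd_ge_0_int[of a b] unfolding m_def coprime_iff_gcd_eq_1
      by (smt (verit) gcd_eq_0_iff prod.inject)
    obtain c d where cd: "a = m * c" "b = m * d"
      by (metis dvdE gcd_dvd1 gcd_dvd2 m_def)
    let ?\<Lambda>' = "(\<lambda>z. hex_point c d * z) ` hexagonal_lattice"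
    have "similar_sublattice hexagonal_lattice ?\<Lambda>'"
      using assms cd unfolding similar_sublattice_hexagonal_iff
      by (intro bexI[of _ "hex_point c d"]) auto
    moreover have "?\<Lambda> = (\<lambda>z. of_int m *\<^sub>R z) ` ?\<Lambda>'"
      by (simp add: image_image scaleR_conv_of_real cd of_int_mult_hex_point[symmetric] mult.assoc)
    ultimately show "\<exists>m \<Lambda>'. m \<ge> 2 \<and> similar_sublattice hexagonal_lattice \<Lambda>' \<and>
      ?\<Lambda> = (\<lambda>z. of_int m *\<^sub>R z) ` \<Lambda>'" using m by blast
  qed
  then show ?thesis unfolding primitive_similar_sublattice_def using sim by blast
qed

text \<open>Sending a generator to its ideal has the orbits of the six units as fibres.
  \<open>P\<close> is a condition on the ideal, not on the generator, so it selects whole fibres; it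
  is instantiated by truth and by primitivity.\<close>

lemma card_similar_sublattices:
  assumes "n > 0"
  shows "6 * card {\<Lambda>. similar_sublattice hexagonal_lattice \<Lambda> \<and> P \<Lambda> \<and>
                       lattice_index hexagonal_lattice \<Lambda> = n}
    = card {(a, b). hex_norm a b = int n \<and> P ((\<lambda>z. hex_point a b * z) ` hexagonal_lattice)}"
proof -
  define I where "I c = (\<lambda>z. c * z) ` hexagonal_lattice" for c
  define Y where "Y = {(a, b). hex_norm a b = int n \<and> P (I (hex_point a b))}"
  define X where "X = (\<lambda>(a, b). hex_point a b) ` Y"
  have "Y \<subseteq> {(a, b). real_of_int (hex_norm a b) \<le> real n}" by (auto simp: Y_def)
  then have "finite Y" by (rule finite_subset) (rule finite_hex_norm_le)
  then have fin: "finite X" by (simp add: X_def)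
  have cardX: "card X = card Y"
    unfolding X_def by (rule card_image) (auto simp: inj_on_def)
  have X_iff: "c \<in> X \<longleftrightarrow> c \<in> hexagonal_lattice \<and> c \<noteq> 0 \<and> (cmod c)\<^sup>2 = real n \<and> P (I c)" for c
  proof -
    have "real_of_int (hex_norm a b) = real n \<longleftrightarrow> hex_norm a b = int n" for a b
      by (metis of_int_eq_iff of_int_of_nat_eq)
    then show ?thesis
      using assms by (auto simp: X_def Y_def hexagonal_lattice_eq cmod_hex_point image_iff)
  qed
  have index: "lattice_index hexagonal_lattice (I c) = n \<longleftrightarrow> (cmod c)\<^sup>2 = real n"
    if "c \<in> hexagonal_lattice" "c \<noteq> 0" for c
  proof -
    from that(1) obtain a b where c: "c = hex_point a b" by (rule hexagonal_latticeE)
    have "nat (hex_norm a b) = n \<longleftrightarrow> real_of_int (hex_norm a b) = real n"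
      using hex_norm_nonneg[of a b] by (metis nat_0_le nat_int of_int_eq_iff of_int_of_nat_eq)
    then show ?thesis
      using lattice_index_principal[of a b] that(2) by (simp add: I_def c cmod_hex_point)
  qed
  have img: "{\<Lambda>. similar_sublattice hexagonal_lattice \<Lambda> \<and> P \<Lambda> \<and>
      lattice_index hexagonal_lattice \<Lambda> = n} = I ` X"
    unfolding similar_sublattice_hexagonal_iff I_def[symmetric] using index X_iff by blast
  have fib: "card {d \<in> X. I d = I c} = 6" if c: "c \<in> X" for c
  proof -
    have "{d \<in> X. I d = I c} = (\<lambda>u. c * u) ` {u \<in> hexagonal_lattice. cmod u = 1}"
    proof (intro equalityI subsetI)
      fix d assume d: "d \<in> {d \<in> X. I d = I c}"
      then have "cmod c = cmod d" using c by (auto simp: X_iff intro: power2_eq_imp_eq)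
      then have "\<exists>u\<in>hexagonal_lattice. cmod u = 1 \<and> d = c * u"
        using principal_eq_iff[of c d] c d by (simp add: X_iff I_def)
      then show "d \<in> (\<lambda>u. c * u) ` {u \<in> hexagonal_lattice. cmod u = 1}" by blast
    next
      fix d assume "d \<in> (\<lambda>u. c * u) ` {u \<in> hexagonal_lattice. cmod u = 1}"
      then obtain u where u: "u \<in> hexagonal_lattice" "cmod u = 1" "d = c * u" by blast
      have norm: "cmod c = cmod d" using u by (simp add: norm_mult)
      have d: "d \<in> hexagonal_lattice" using u c hexagonal_lattice_mult by (simp add: X_iff)
      have "I d = I c" unfolding I_def
        using principal_eq_iff[of c d] c u norm d by (auto simp: X_iff)
      moreover from this have "d \<in> X" using c d norm unfolding X_iff by auto
      ultimately show "d \<in> {d \<in> X. I d = I c}" by simp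
    qed
    moreover have "inj_on (\<lambda>u. c * u) {u \<in> hexagonal_lattice. cmod u = 1}"
      using c by (auto simp: inj_on_def X_iff)
    ultimately show ?thesis by (simp add: card_image card_hexagonal_units)
  qed
  have "card X = (\<Sum>\<Lambda>\<in>I ` X. card {d \<in> X. I d = \<Lambda>})"
    using sum.image_gen[OF fin, of "\<lambda>_. 1 :: nat" I] by simp
  also have "\<dots> = (\<Sum>\<Lambda>\<in>I ` X. 6)" by (rule sum.cong) (auto simp: fib)
  finally show ?thesis unfolding img cardX by (simp add: Y_def I_def)
qed

section \<open>Counting lattice points\<close>

text \<open>Rectangular fundamental domains, laid like bricks, whose area needs no determinant.\<close>

definition hex_brick :: "int \<times> int \<Rightarrow> complex set" where
  "hex_brick = (\<lambda>(a, b). cbox (hex_point a b) (hex_point a b + Complex 1 (sqrt 3 / 2)))"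

text \<open>Open bricks are disjoint and closed ones cover the plane. Additivity over the former
  bounds the count from above and subadditivity over the latter from below, so shared edges need no
  null set argument.\<close>

definition open_hex_brick :: "int \<times> int \<Rightarrow> complex set" where
  "open_hex_brick = (\<lambda>(a, b). box (hex_point a b) (hex_point a b + Complex 1 (sqrt 3 / 2)))"

lemma measure_hex_brick: "measure lebesgue (hex_brick p) = sqrt 3 / 2"
  and measure_open_hex_brick: "measure lebesgue (open_hex_brick p) = sqrt 3 / 2"
proof -
  have "measure lebesgue (cbox z (z + Complex 1 (sqrt 3 / 2))) = sqrt 3 / 2"
    "measure lebesgue (box z (z + Complex 1 (sqrt 3 / 2))) = sqrt 3 / 2" for z
    by (simp_all add: measure_lborel_cbox_eq measure_lborel_box_eq Basis_complex_def inner_complex_def)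
  then show "measure lebesgue (hex_brick p) = sqrt 3 / 2"
    "measure lebesgue (open_hex_brick p) = sqrt 3 / 2"
    by (simp_all add: hex_brick_def open_hex_brick_def split_beta)
qed

text \<open>Both sides of a brick are at most 1, and the modulus is at most the sum of the
  coordinate distances. This crude 2 is the change of radius in the disc comparison.\<close>

lemma dist_hex_brick:
  assumes "z \<in> hex_brick (a, b)"
  shows "cmod (z - hex_point a b) \<le> 2"
proof -
  have "\<bar>Re (z - hex_point a b)\<bar> \<le> 1" "\<bar>Im (z - hex_point a b)\<bar> \<le> sqrt 3 / 2"
    using assms by (auto simp: hex_brick_def in_cbox_complex_iff)
  moreover have "sqrt 3 \<le> 2" by (rule real_le_lsqrt) auto
  ultimately show ?thesis using cmod_le[of "z - hex_point a b"] by linarith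
qed

text \<open>The height of z determines the row b; row b is shifted by b/2, so this shift is removed
  before rounding the real part.\<close>

lemma hex_brick_cover: "\<exists>p. z \<in> hex_brick p"
proof -
  define b where "b = \<lfloor>Im z / (sqrt 3 / 2)\<rfloor>"
  define a where "a = \<lfloor>Re z - of_int b / 2\<rfloor>"
  have "of_int b \<le> Im z / (sqrt 3 / 2)" "Im z / (sqrt 3 / 2) \<le> of_int b + 1"
    unfolding b_def by linarith+
  then have "of_int b * (sqrt 3 / 2) \<le> Im z" "Im z \<le> (of_int b + 1) * (sqrt 3 / 2)"
    by (simp_all only: le_divide_eq divide_le_eq) simp_all
  moreover have "of_int a \<le> Re z - of_int b / 2" "Re z - of_int b / 2 \<le> of_int a + 1"
    unfolding a_def by linarith+
  ultimately have "z \<in> hex_brick (a, b)"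
    by (simp add: hex_brick_def in_cbox_complex_iff algebra_simps)
  then show ?thesis ..
qed

lemma disjoint_open_hex_brick: "p \<noteq> q \<Longrightarrow> open_hex_brick p \<inter> open_hex_brick q = {}"
proof (rule ccontr)
  assume "p \<noteq> q" "open_hex_brick p \<inter> open_hex_brick q \<noteq> {}"
  then obtain z where z: "z \<in> open_hex_brick p" "z \<in> open_hex_brick q" by blast
  obtain a b c d where pq: "p = (a, b)" "q = (c, d)" by (cases p, cases q)
  have b: "of_int b * (sqrt 3 / 2) < Im z" "Im z < (of_int b + 1) * (sqrt 3 / 2)"
    and d: "of_int d * (sqrt 3 / 2) < Im z" "Im z < (of_int d + 1) * (sqrt 3 / 2)"
    using z by (auto simp: pq open_hex_brick_def in_box_complex_iff algebra_simps)
  have "of_int b * (sqrt 3 / 2) < (of_int d + 1) * (sqrt 3 / 2)"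
    "of_int d * (sqrt 3 / 2) < (of_int b + 1) * (sqrt 3 / 2)"
    using b d by linarith+
  then have "of_int b < (of_int d + 1 :: real)" "of_int d < (of_int b + 1 :: real)"
    by (simp_all only: mult_less_cancel_right) auto
  then have "b = d" by linarith
  moreover have "of_int a + of_int b / 2 < Re z" "Re z < of_int a + of_int b / 2 + 1"
    "of_int c + of_int d / 2 < Re z" "Re z < of_int c + of_int d / 2 + 1"
    using z by (auto simp: pq open_hex_brick_def in_box_complex_iff algebra_simps)
  ultimately have "a = c" by linarith
  with \<open>b = d\<close> \<open>p \<noteq> q\<close> pq show False by simp
qed

lemma cmod_hex_point_le_iff:
  assumes "x \<ge> 0"
  shows "cmod (hex_point a b) \<le> sqrt x \<longleftrightarrow> of_int (hex_norm a b) \<le> x"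
proof -
  have "cmod (hex_point a b) = sqrt (of_int (hex_norm a b))"
    by (rule real_sqrt_unique[symmetric]) (simp_all add: cmod_hex_point)
  then show ?thesis by simp
qed

text \<open>Gauss' argument: the bricks of the lattice points in a disc of radius \<open>r\<close> cover the disc
  of radius \<open>r - 2\<close> and lie in the disc of radius \<open>r + 2\<close>.\<close>

lemma hex_lattice_points_bounds:
  assumes "x \<ge> 0"
  defines "n \<equiv> real (card {(a, b). of_int (hex_norm a b) \<le> x})"
  shows "n * (sqrt 3 / 2) \<le> pi * (sqrt x + 2)\<^sup>2"
    and "sqrt x \<ge> 2 \<Longrightarrow> pi * (sqrt x - 2)\<^sup>2 \<le> n * (sqrt 3 / 2)"
proof -
  define S where "S = {(a, b). of_int (hex_norm a b) \<le> x}"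
  have fin: "finite S" unfolding S_def by (rule finite_hex_norm_le)
  have n: "n = real (card S)" by (simp add: n_def S_def)
  have S_iff: "(a, b) \<in> S \<longleftrightarrow> cmod (hex_point a b) \<le> sqrt x" for a b
    using cmod_hex_point_le_iff[OF assms(1)] by (simp add: S_def)
  have brick: "hex_brick p \<in> lmeasurable" for p
    by (simp add: hex_brick_def split: prod.split)
  have open_brick: "open_hex_brick p \<in> lmeasurable" for p
    by (simp add: open_hex_brick_def split: prod.split)
  have "n * (sqrt 3 / 2) = (\<Sum>p\<in>S. measure lebesgue (open_hex_brick p))"
    by (simp add: n measure_open_hex_brick)
  also have "\<dots> = measure lebesgue (\<Union>p\<in>S. open_hex_brick p)"
    using fin open_brick disjoint_open_hex_brick
    by (intro measure_UNION'[symmetric]) (auto simp: pairwise_def disjnt_def)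
  also have "\<dots> \<le> measure lebesgue (cball 0 (sqrt x + 2) :: complex set)"
  proof (rule measure_mono_fmeasurable)
    show "(\<Union>p\<in>S. open_hex_brick p) \<subseteq> cball 0 (sqrt x + 2)"
    proof
      fix z assume "z \<in> (\<Union>p\<in>S. open_hex_brick p)"
      then obtain a b where ab: "(a, b) \<in> S" "z \<in> open_hex_brick (a, b)" by auto
      then have "z \<in> hex_brick (a, b)"
        using box_subset_cbox by (auto simp: hex_brick_def open_hex_brick_def)
      then have "cmod (z - hex_point a b) \<le> 2" by (rule dist_hex_brick)
      moreover have "cmod (hex_point a b) \<le> sqrt x" using ab by (simp add: S_iff)
      ultimately have "cmod z \<le> sqrt x + 2"
        using norm_triangle_ineq[of "hex_point a b" "z - hex_point a b"] by simp
      then show "z \<in> cball 0 (sqrt x + 2)" by simp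
    qed
    show "(\<Union>p\<in>S. open_hex_brick p) \<in> sets lebesgue"
      using fin open_brick by (intro sets.finite_UN) (auto simp: fmeasurableD)
  qed auto
  also have "\<dots> = pi * (sqrt x + 2)\<^sup>2"
    using assms(1) by (simp add: content_cball unit_ball_vol_2)
  finally show "n * (sqrt 3 / 2) \<le> pi * (sqrt x + 2)\<^sup>2" .
  assume x: "sqrt x \<ge> 2"
  have "pi * (sqrt x - 2)\<^sup>2 = measure lebesgue (cball 0 (sqrt x - 2) :: complex set)"
    using x by (simp add: content_cball unit_ball_vol_2)
  also have "\<dots> \<le> measure lebesgue (\<Union>p\<in>S. hex_brick p)"
  proof (rule measure_mono_fmeasurable)
    show "cball 0 (sqrt x - 2) \<subseteq> (\<Union>p\<in>S. hex_brick p)"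
    proof
      fix z :: complex assume z: "z \<in> cball 0 (sqrt x - 2)"
      obtain a b where ab: "z \<in> hex_brick (a, b)" using hex_brick_cover[of z] by auto
      then have "cmod (z - hex_point a b) \<le> 2" by (rule dist_hex_brick)
      then have "(a, b) \<in> S" unfolding S_iff
        using z norm_triangle_ineq[of z "hex_point a b - z"] by (simp add: norm_minus_commute)
      then show "z \<in> (\<Union>p\<in>S. hex_brick p)" using ab by blast
    qed
    show "(\<Union>p\<in>S. hex_brick p) \<in> lmeasurable"
      using fin brick by (intro fmeasurable.finite_UN) auto
  qed auto
  also have "\<dots> \<le> (\<Sum>p\<in>S. measure lebesgue (hex_brick p))"
    using fin brick by (intro measure_UNION_le) (auto simp: fmeasurableD)
  also have "\<dots> = n * (sqrt 3 / 2)"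
    by (simp add: n measure_hex_brick)
  finally show "pi * (sqrt x - 2)\<^sup>2 \<le> n * (sqrt 3 / 2)" .
qed

text \<open>For r = sqrt x \<ge> 1 the areas of the discs of radius r + 2 and r - 2 differ from pi
  r^2 by at most 8 pi r. Dividing by the brick area multiplies by 2 / sqrt 3 \<le> 2, hence 16 pi;
  the extra 1 pays for the origin.\<close>

lemma card_nonzero_hex_points_asymp:
  obtains K where "K \<ge> 0"
    "\<And>x. x \<ge> 1 \<Longrightarrow> \<bar>real (card {(a, b). (a, b) \<noteq> (0, 0) \<and> of_int (hex_norm a b) \<le> x})
        - 2 * pi / sqrt 3 * x\<bar> \<le> K * sqrt x"
proof
  show "(16 * pi + 1 :: real) \<ge> 0" by simp
  fix x :: real assume x: "x \<ge> 1"
  define r where "r = sqrt x"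
  have r: "r \<ge> 1" "x = r\<^sup>2" using x by (simp_all add: r_def)
  define n where "n = real (card {(a, b). of_int (hex_norm a b) \<le> x})"
  have "{(a, b). (a, b) \<noteq> (0, 0) \<and> of_int (hex_norm a b) \<le> x}
      = {(a, b). of_int (hex_norm a b) \<le> x} - {(0, 0)}" by auto
  moreover have "(0, 0) \<in> {(a, b). of_int (hex_norm a b) \<le> x}" using x by (simp add: hex_norm_def)
  moreover have "card {(a, b). of_int (hex_norm a b) \<le> x} > 0"
    using calculation(2) finite_hex_norm_le[of x] card_gt_0_iff by blast
  ultimately have card: "real (card {(a, b). (a, b) \<noteq> (0, 0) \<and> of_int (hex_norm a b) \<le> x}) = n - 1"
    by (simp add: n_def card_Diff_singleton of_nat_diff)
  have upper: "n * (sqrt 3 / 2) \<le> pi * (r + 2)\<^sup>2"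
    using hex_lattice_points_bounds(1)[of x] x by (simp add: n_def r_def)
  have "n * (sqrt 3 / 2) - pi * r\<^sup>2 \<le> pi * (8 * r)"
  proof -
    have "pi * (r + 2)\<^sup>2 = pi * r\<^sup>2 + pi * (4 * r + 4)" by (simp add: power2_eq_square algebra_simps)
    moreover have "pi * (4 * r + 4) \<le> pi * (8 * r)" using r by (intro mult_left_mono) auto
    ultimately show ?thesis using upper by linarith
  qed
  moreover have "pi * r\<^sup>2 - n * (sqrt 3 / 2) \<le> pi * (8 * r)"
  proof (cases "r \<ge> 2")
    case True
    then have "pi * (r - 2)\<^sup>2 \<le> n * (sqrt 3 / 2)"
      using hex_lattice_points_bounds(2)[of x] x by (simp add: n_def r_def)
    moreover have "pi * (r - 2)\<^sup>2 = pi * r\<^sup>2 - pi * (4 * r - 4)" by (simp add: power2_eq_square algebra_simps)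
    moreover have "pi * (4 * r - 4) \<le> pi * (8 * r)" using r by (intro mult_left_mono) auto
    ultimately show ?thesis by linarith
  next
    \<comment> \<open>For r < 2 there is no inner disc, but pi r^2 itself is within the
      error.\<close>
    case False
    then have "r\<^sup>2 \<le> 8 * r" using r by (simp add: power2_eq_square)
    then have "pi * r\<^sup>2 \<le> pi * (8 * r)" by simp
    moreover have "n * (sqrt 3 / 2) \<ge> 0" by (simp add: n_def)
    ultimately show ?thesis by linarith
  qed
  ultimately have *: "\<bar>n * (sqrt 3 / 2) - pi * r\<^sup>2\<bar> \<le> pi * (8 * r)" by linarith
  have "n - 2 * pi / sqrt 3 * x = (n * (sqrt 3 / 2) - pi * r\<^sup>2) * (2 / sqrt 3)"
    by (simp add: r(2) field_simps)
  then have "\<bar>n - 2 * pi / sqrt 3 * x\<bar> = \<bar>n * (sqrt 3 / 2) - pi * r\<^sup>2\<bar> * (2 / sqrt 3)"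
    by (simp only: abs_mult) simp
  also have "\<dots> \<le> pi * (8 * r) * 2"
    using * r by (intro mult_mono) (auto simp: field_simps)
  finally have "\<bar>n - 2 * pi / sqrt 3 * x\<bar> \<le> 16 * pi * r" by simp
  then show "\<bar>real (card {(a, b). (a, b) \<noteq> (0, 0) \<and> of_int (hex_norm a b) \<le> x})
      - 2 * pi / sqrt 3 * x\<bar> \<le> (16 * pi + 1) * sqrt x"
    unfolding card r_def[symmetric] using r(1) by (simp add: algebra_simps)
qed

section \<open>Summatory functions\<close>

definition count_nonzero :: "real \<Rightarrow> real" where
  "count_nonzero x = real (card {(a, b). (a, b) \<noteq> (0, 0) \<and> of_int (hex_norm a b) \<le> x})"

text \<open>The origin is excluded automatically, since \<open>gcd 0 0 = 0\<close>.\<close>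

definition count_coprime :: "real \<Rightarrow> real" where
  "count_coprime x = real (card {(a, b). coprime a b \<and> of_int (hex_norm a b) \<le> x})"

lemma sum_card_hex_norm_eq:
  "(\<Sum>n | 1 \<le> n \<and> real n \<le> x. card {(a, b). hex_norm a b = int n \<and> P a b})
    = card {(a, b). (a, b) \<noteq> (0, 0) \<and> of_int (hex_norm a b) \<le> x \<and> P a b}"
proof -
  let ?I = "{n. 1 \<le> n \<and> real n \<le> x}"
  let ?A = "\<lambda>n. {(a, b). hex_norm a b = int n \<and> P a b}"
  have fin: "finite ?I"
    by (rule finite_subset[of _ "{..nat \<lfloor>x\<rfloor>}"]) (auto simp: le_nat_floor)
  have finA: "finite (?A n)" for n
    by (rule finite_subset[OF _ finite_hex_norm_le[of "real n"]]) auto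
  have "(\<Union>n\<in>?I. ?A n) = {(a, b). (a, b) \<noteq> (0, 0) \<and> of_int (hex_norm a b) \<le> x \<and> P a b}"
  proof (intro equalityI subsetI)
    fix p assume "p \<in> {(a, b). (a, b) \<noteq> (0, 0) \<and> of_int (hex_norm a b) \<le> x \<and> P a b}"
    then obtain a b where p: "p = (a, b)" "(a, b) \<noteq> (0, 0)" "of_int (hex_norm a b) \<le> x" "P a b"
      by auto
    have "hex_norm a b > 0" using p(2) by (rule hex_norm_pos)
    then have "nat (hex_norm a b) \<in> ?I" "p \<in> ?A (nat (hex_norm a b))" using p by auto
    then show "p \<in> (\<Union>n\<in>?I. ?A n)" by blast
  next
    fix p assume "p \<in> (\<Union>n\<in>?I. ?A n)"
    then show "p \<in> {(a, b). (a, b) \<noteq> (0, 0) \<and> of_int (hex_norm a b) \<le> x \<and> P a b}"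
      by auto
  qed
  moreover have "\<forall>i\<in>?I. \<forall>j\<in>?I. i \<noteq> j \<longrightarrow> ?A i \<inter> ?A j = {}" by auto
  ultimately show ?thesis
    using card_UN_disjoint[of ?I ?A] fin finA by simp
qed

lemma sum_b_hex: "(\<Sum>n | 1 \<le> n \<and> real n \<le> x. real (b_hex n)) = count_nonzero x / 6"
proof -
  have "6 * b_hex n = card {(a, b). hex_norm a b = int n \<and> True}" if "1 \<le> n" for n
    using card_similar_sublattices[of n "\<lambda>_. True"] that by (simp add: b_hex_def)
  then have "6 * (\<Sum>n | 1 \<le> n \<and> real n \<le> x. b_hex n)
      = card {(a, b). (a, b) \<noteq> (0, 0) \<and> of_int (hex_norm a b) \<le> x \<and> True}"
    unfolding sum_card_hex_norm_eq[symmetric] sum_distrib_left by (intro sum.cong) auto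
  then have "real (6 * (\<Sum>n | 1 \<le> n \<and> real n \<le> x. b_hex n)) = count_nonzero x"
    by (simp only: count_nonzero_def simp_thms)
  then show ?thesis by simp
qed

lemma sum_b_hex_pr: "(\<Sum>n | 1 \<le> n \<and> real n \<le> x. real (b_hex_pr n)) = count_coprime x / 6"
proof -
  have "6 * b_hex_pr n = card {(a, b). hex_norm a b = int n \<and> coprime a b}" if n: "1 \<le> n" for n
  proof -
    have "{\<Lambda>. primitive_similar_sublattice hexagonal_lattice \<Lambda> \<and> lattice_index hexagonal_lattice \<Lambda> = n}
      = {\<Lambda>. similar_sublattice hexagonal_lattice \<Lambda> \<and> primitive_similar_sublattice hexagonal_lattice \<Lambda>
            \<and> lattice_index hexagonal_lattice \<Lambda> = n}"
      by (auto simp: primitive_similar_sublattice_def)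
    moreover have "hex_norm a b = int n \<and> primitive_similar_sublattice hexagonal_lattice
          ((\<lambda>z. hex_point a b * z) ` hexagonal_lattice) \<longleftrightarrow> hex_norm a b = int n \<and> coprime a b" for a b
      using primitive_principal_iff[of a b] hex_norm_eq_0_iff[of a b] n by fastforce
    ultimately show ?thesis
      using card_similar_sublattices[of n "primitive_similar_sublattice hexagonal_lattice"] n
      by (simp add: b_hex_pr_def)
  qed
  then have "6 * (\<Sum>n | 1 \<le> n \<and> real n \<le> x. b_hex_pr n)
      = card {(a, b). (a, b) \<noteq> (0, 0) \<and> of_int (hex_norm a b) \<le> x \<and> coprime a b}"
    unfolding sum_card_hex_norm_eq[symmetric] sum_distrib_left by (intro sum.cong) auto
  also have "{(a, b). (a, b) \<noteq> (0, 0) \<and> of_int (hex_norm a b) \<le> x \<and> coprime a b}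
      = {(a, b). coprime a b \<and> of_int (hex_norm a b) \<le> x}" by auto
  finally have "real (6 * (\<Sum>n | 1 \<le> n \<and> real n \<le> x. b_hex_pr n)) = count_coprime x"
    by (simp only: count_coprime_def)
  then show ?thesis by simp
qed

text \<open>Dividing a point by the gcd m of its coordinates divides the norm by m^2. Any N beyond
  sqrt x will do, as further terms count nothing; this freedom allows \<open>N div m\<close> as the
  bound when x is replaced by x/m^2.\<close>

lemma count_nonzero_eq_sum_coprime:
  assumes N: "\<And>m :: nat. (real m)\<^sup>2 \<le> x \<Longrightarrow> m \<le> N"
  shows "count_nonzero x = (\<Sum>m=1..N. count_coprime (x / (real m)\<^sup>2))"
proof -
  define C where "C m = {(a, b). coprime a b \<and> of_int (hex_norm a b) \<le> x / (real m)\<^sup>2}" for m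
  define f where "f = (\<lambda>(m :: nat, a, b). (int m * a, int m * b))"
  define A where "A = {(a, b). (a, b) \<noteq> (0, 0) \<and> real_of_int (hex_norm a b) \<le> x}"
  have norm: "real_of_int (hex_norm (int m * a) (int m * b)) \<le> x \<longleftrightarrow>
      real_of_int (hex_norm a b) \<le> x / (real m)\<^sup>2" if "m \<ge> 1" for m a b
    using that by (simp only: hex_norm_mult_left) (simp add: field_simps)
  have "bij_betw f (Sigma {1..N} C) A"
  proof (rule bij_betw_imageI)
    show "inj_on f (Sigma {1..N} C)"
    proof (rule inj_onI)
      fix p q assume pq: "p \<in> Sigma {1..N} C" "q \<in> Sigma {1..N} C" and eq: "f p = f q"
      obtain m a b n c d where p: "p = (m, a, b)" and q: "q = (n, c, d)"
        by (cases p, cases q)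
      have cop: "gcd a b = 1" "gcd c d = 1" "m \<ge> 1" using pq by (auto simp: p q C_def)
      have eqs: "int m * a = int n * c" "int m * b = int n * d" using eq by (auto simp: f_def p q)
      have "gcd (int m * a) (int m * b) = int m" "gcd (int n * c) (int n * d) = int n"
        using cop by (simp_all add: gcd_mult_distrib_int[symmetric])
      then have "m = n" using eqs by simp
      then show "p = q" using eqs cop by (simp add: p q)
    qed
    show "f ` Sigma {1..N} C = A"
    proof (intro equalityI subsetI)
      fix p assume "p \<in> f ` Sigma {1..N} C"
      then obtain m a b where p: "p = (int m * a, int m * b)" "m \<in> {1..N}" "(a, b) \<in> C m"
        by (auto simp: f_def)
      then have "(a, b) \<noteq> (0, 0)" by (auto simp: C_def)
      then show "p \<in> A" using p norm[of m a b] by (auto simp: A_def C_def)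
    next
      fix p assume "p \<in> A"
      then obtain a b where p: "p = (a, b)" "(a, b) \<noteq> (0, 0)" "real_of_int (hex_norm a b) \<le> x"
        by (auto simp: A_def)
      define m where "m = nat (gcd a b)"
      have m: "int m = gcd a b" "m \<ge> 1" using p(2) by (auto simp: m_def Suc_le_eq)
      obtain c d where cd: "a = int m * c" "b = int m * d"
        using m(1) by (metis dvdE gcd_dvd1 gcd_dvd2)
      have "int m * gcd c d = gcd a b" unfolding cd by (simp add: gcd_mult_distrib_int[symmetric])
      then have "int m * gcd c d = int m" by (simp only: m(1))
      then have cop: "coprime c d" using m(2) by (simp add: coprime_iff_gcd_eq_1)
      have cC: "(c, d) \<in> C m" using cop p(3) norm[OF m(2), of c d] by (simp add: C_def cd)
      \<comment> \<open>The reduced point has norm at least 1, so m^2 \<le> x and m is within reach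
        of N.\<close>
      have "hex_norm c d \<ge> 1" using hex_norm_pos[of c d] cop by force
      then have "(1::real) \<le> x / (real m)\<^sup>2" using cC by (simp add: C_def)
      then have "(real m)\<^sup>2 \<le> x" using m(2) by (simp add: field_simps)
      then have "m \<le> N" by (rule N)
      then have "(m, c, d) \<in> Sigma {1..N} C" using m(2) cC by simp
      moreover have "p = f (m, c, d)" by (simp add: f_def p(1) cd)
      ultimately show "p \<in> f ` Sigma {1..N} C" by blast
    qed
  qed
  then have "card A = card (Sigma {1..N} C)" by (rule bij_betw_same_card[symmetric])
  also have "\<dots> = (\<Sum>m=1..N. card (C m))"
  proof (rule card_SigmaI)
    show "\<forall>m\<in>{1..N}. finite (C m)"
      unfolding C_def by (auto intro!: finite_subset[OF _ finite_hex_norm_le])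
  qed simp
  finally show ?thesis by (simp add: count_nonzero_def count_coprime_def A_def C_def)
qed

text \<open>Inversion for g n = \<open>count_coprime (x / n^2)\<close>: the sum of g over the
  multiples of m is the count of all nonzero points at x/m^2.\<close>

lemma count_coprime_moebius:
  assumes "x \<ge> 1" and "N = nat \<lfloor>sqrt x\<rfloor>"
  shows "count_coprime x = (\<Sum>m=1..N. moebius_mu m * count_nonzero (x / (real m)\<^sup>2))"
proof -
  have "N > 0" using assms by (simp add: le_floor_iff)
  have inner: "count_nonzero (x / (real m)\<^sup>2) = (\<Sum>k=1..N div m. count_coprime (x / (real (m * k))\<^sup>2))"
    if m: "m \<in> {1..N}" for m
  proof -
    have "k \<le> N div m" if "(real k)\<^sup>2 \<le> x / (real m)\<^sup>2" for k
    proof -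
      have "(real (k * m))\<^sup>2 \<le> x" using that m by (simp add: field_simps power_mult_distrib)
      then have "real (k * m) \<le> sqrt x" by (rule real_le_rsqrt)
      then have "k * m \<le> N" unfolding assms(2) by (rule le_nat_floor)
      then show ?thesis using m by (simp add: less_eq_div_iff_mult_less_eq)
    qed
    then show ?thesis
      by (subst count_nonzero_eq_sum_coprime) (auto simp: power_mult_distrib)
  qed
  have "count_coprime x
      = (\<Sum>m=1..N. moebius_mu m * (\<Sum>k=1..N div m. count_coprime (x / (real (m * k))\<^sup>2)))"
    using moebius_inversion_multiples[OF \<open>N > 0\<close>, of "\<lambda>n. count_coprime (x / (real n)\<^sup>2)"] by simp
  also have "\<dots> = (\<Sum>m=1..N. moebius_mu m * count_nonzero (x / (real m)\<^sup>2))"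
    by (intro sum.cong refl) (simp add: inner)
  finally show ?thesis .
qed

lemma count_coprime_asymp:
  obtains K where "K \<ge> 0"
    "\<And>x. x \<ge> 1 \<Longrightarrow> \<bar>count_coprime x - 2 * pi / sqrt 3 / (pi\<^sup>2 / 6) * x\<bar> \<le> K * (sqrt x * (1 + ln x))"
proof -
  obtain K where K: "K \<ge> 0"
    "\<And>x. x \<ge> 1 \<Longrightarrow> \<bar>count_nonzero x - 2 * pi / sqrt 3 * x\<bar> \<le> K * sqrt x"
    using card_nonzero_hex_points_asymp unfolding count_nonzero_def by blast
  define c where "c = 2 * pi / sqrt 3"
  define z where "z = pi\<^sup>2 / 6"
  have c: "c \<ge> 0" and z: "z > 0" by (simp_all add: c_def z_def)
  show thesis
  proof (rule that)
    show "K + 4 * c / z \<ge> 0" using K(1) c z by simp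
    fix x :: real assume x: "x \<ge> 1"
    define N where "N = nat \<lfloor>sqrt x\<rfloor>"
    have N: "N > 0" "real N \<le> sqrt x" "sqrt x \<le> real N + 1"
      using x by (simp_all add: N_def le_floor_iff)
    \<comment> \<open>As N \<ge> 1, rounding down at most halves sqrt x. This turns the bound 2
      \<open>harm N\<close> / N into 4 (1 + ln x) / sqrt x.\<close>
    have sqrt_le: "sqrt x \<le> 2 * real N" using N by linarith
    have harm: "harm N \<le> 1 + ln x"
    proof -
      have "sqrt x \<le> x" using x self_le_power[of x 2] by (intro real_le_lsqrt) auto
      then have "ln (real N) \<le> ln x" using N x by (subst ln_le_cancel_iff) auto
      then show ?thesis using harm_le_ln[OF N(1)] by linarith
    qed
    define M where "M = (\<Sum>m=1..N. moebius_mu m / (real m)\<^sup>2)"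
    have "count_coprime x - c * x * M
        = (\<Sum>m=1..N. moebius_mu m * (count_nonzero (x / (real m)\<^sup>2) - c * (x / (real m)\<^sup>2)))"
      unfolding count_coprime_moebius[OF x N_def] M_def
      by (simp add: sum_distrib_left sum_subtractf right_diff_distrib mult_ac)
    also have "\<bar>\<dots>\<bar> \<le> (\<Sum>m=1..N. K * sqrt x * inverse (real m))"
    proof (rule order.trans[OF sum_abs sum_mono])
      fix m assume m: "m \<in> {1..N}"
      \<comment> \<open>Restricting to m \<le> sqrt x keeps x/m^2 \<ge> 1, the range where the point
        count estimate holds.\<close>
      then have "real m \<le> sqrt x" using N(2) by (meson atLeastAtMost_iff of_nat_le_iff order.trans)
      then have "(real m)\<^sup>2 \<le> (sqrt x)\<^sup>2" by (intro power_mono) auto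
      then have "x / (real m)\<^sup>2 \<ge> 1" using m x by simp
      moreover have "sqrt (x / (real m)\<^sup>2) = sqrt x * inverse (real m)"
        by (simp only: real_sqrt_divide) (simp add: divide_inverse)
      ultimately have "\<bar>count_nonzero (x / (real m)\<^sup>2) - c * (x / (real m)\<^sup>2)\<bar> \<le> K * sqrt x * inverse (real m)"
        using K(2)[of "x / (real m)\<^sup>2"] by (simp only: c_def mult.assoc)
      then have "\<bar>moebius_mu m\<bar> * \<bar>count_nonzero (x / (real m)\<^sup>2) - c * (x / (real m)\<^sup>2)\<bar>
          \<le> 1 * (K * sqrt x * inverse (real m))"
        using abs_moebius_mu_le by (intro mult_mono) auto
      then show "\<bar>moebius_mu m * (count_nonzero (x / (real m)\<^sup>2) - c * (x / (real m)\<^sup>2))\<bar>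
          \<le> K * sqrt x * inverse (real m)" by (simp add: abs_mult)
    qed
    also have "\<dots> = K * sqrt x * harm N" by (simp add: harm_def sum_distrib_left)
    also have "\<dots> \<le> K * sqrt x * (1 + ln x)" using harm K(1) x by (intro mult_left_mono) auto
    finally have 1: "\<bar>count_coprime x - c * x * M\<bar> \<le> K * (sqrt x * (1 + ln x))" by (simp add: mult.assoc)
    have "\<bar>c * x * M - c / z * x\<bar> = \<bar>c * x / z * (z * M - 1)\<bar>"
      using z by (intro arg_cong[of _ _ abs]) (simp add: field_simps)
    also have "\<dots> = c * x / z * \<bar>z * M - 1\<bar>" using c x z by (simp add: abs_mult)
    also have "\<dots> \<le> c * x / z * (2 * harm N / real N)"
      using sum_moebius_mu_over_squares[OF N(1)] c x z
      by (intro mult_left_mono) (simp_all add: M_def z_def)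
    also have "\<dots> \<le> c * x / z * (4 * (1 + ln x) / sqrt x)"
    proof (rule mult_left_mono)
      have "2 * harm N / real N \<le> 2 * (1 + ln x) / (sqrt x / 2)"
        using harm N x sqrt_le by (intro frac_le) auto
      then show "2 * harm N / real N \<le> 4 * (1 + ln x) / sqrt x" by simp
    qed (use c x z in simp)
    also have "\<dots> = 4 * c / z * ((x / sqrt x) * (1 + ln x))" by simp
    also have "x / sqrt x = sqrt x" using x by (intro real_div_sqrt) simp
    finally have 2: "\<bar>c * x * M - c / z * x\<bar> \<le> 4 * c / z * (sqrt x * (1 + ln x))" .
    have "\<bar>count_coprime x - c / z * x\<bar> \<le> (K + 4 * c / z) * (sqrt x * (1 + ln x))"
      unfolding distrib_right using 1 2 by linarith
    then show "\<bar>count_coprime x - 2 * pi / sqrt 3 / (pi\<^sup>2 / 6) * x\<bar>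
        \<le> (K + 4 * c / z) * (sqrt x * (1 + ln x))" by (simp only: c_def z_def)
  qed
qed

theorem theoremB2:
  shows "(\<lambda>x::real. (\<Sum>n | 1 \<le> n \<and> real n \<le> x. real (b_hex n)) - L_chi3 1 * x)
           \<in> O[at_top](\<lambda>x. sqrt x) \<and>
         (\<lambda>x::real. (\<Sum>n | 1 \<le> n \<and> real n \<le> x. real (b_hex n)) - pi / (3 * sqrt 3) * x)
           \<in> O[at_top](\<lambda>x. sqrt x) \<and>
         L_chi3 1 = pi / (3 * sqrt 3) \<and>
         (\<lambda>x::real. (\<Sum>n | 1 \<le> n \<and> real n \<le> x. real (b_hex_pr n)) - L_chi3 1 / zeta_series 2 * x)
           \<in> O[at_top](\<lambda>x. sqrt x * ln x) \<and>
         (\<lambda>x::real. (\<Sum>n | 1 \<le> n \<and> real n \<le> x. real (b_hex_pr n)) - 2 / (pi * sqrt 3) * x)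
           \<in> O[at_top](\<lambda>x. sqrt x * ln x) \<and>
         L_chi3 1 / zeta_series 2 = 2 / (pi * sqrt 3)"
proof -
  have const: "L_chi3 1 / zeta_series 2 = 2 / (pi * sqrt 3)"
    by (simp add: L_chi3_1 zeta_series_2 field_simps power2_eq_square)
  obtain K where K: "K \<ge> 0"
    "\<And>x. x \<ge> 1 \<Longrightarrow> \<bar>count_nonzero x - 2 * pi / sqrt 3 * x\<bar> \<le> K * sqrt x"
    using card_nonzero_hex_points_asymp unfolding count_nonzero_def by blast
  have 1: "(\<lambda>x. (\<Sum>n | 1 \<le> n \<and> real n \<le> x. real (b_hex n)) - pi / (3 * sqrt 3) * x)
      \<in> O[at_top](\<lambda>x. sqrt x)"
  \<comment> \<open>The summand 1 only makes the constant positive, as K may be 0.\<close>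
  proof (rule landau_o.bigI[of "K / 6 + 1"])
    show "K / 6 + 1 > 0" using K(1) by simp
    show "\<forall>\<^sub>F x in at_top. norm ((\<Sum>n | 1 \<le> n \<and> real n \<le> x. real (b_hex n)) - pi / (3 * sqrt 3) * x)
        \<le> (K / 6 + 1) * norm (sqrt x)"
      using eventually_ge_at_top[of 1]
    proof eventually_elim
      case (elim x)
      have "pi / (3 * sqrt 3) * x = 2 * pi / sqrt 3 * x / 6" by simp
      then have "\<bar>count_nonzero x / 6 - pi / (3 * sqrt 3) * x\<bar>
          = \<bar>count_nonzero x - 2 * pi / sqrt 3 * x\<bar> / 6"
        by (simp only: diff_divide_distrib[symmetric]) simp
      also have "\<dots> \<le> K * sqrt x / 6" using K(2)[OF elim] by simp
      also have "\<dots> \<le> (K / 6 + 1) * sqrt x" using elim by (simp add: distrib_right)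
      finally show ?case unfolding sum_b_hex using elim by simp
    qed
  qed
  obtain K' where K': "K' \<ge> 0"
    "\<And>x. x \<ge> 1 \<Longrightarrow> \<bar>count_coprime x - 2 * pi / sqrt 3 / (pi\<^sup>2 / 6) * x\<bar> \<le> K' * (sqrt x * (1 + ln x))"
    using count_coprime_asymp by blast
  have 2: "(\<lambda>x. (\<Sum>n | 1 \<le> n \<and> real n \<le> x. real (b_hex_pr n)) - 2 / (pi * sqrt 3) * x)
      \<in> O[at_top](\<lambda>x. sqrt x * ln x)"
  \<comment> \<open>For x \<ge> e one has 1 + ln x \<le> 2 ln x, so K'/6 becomes K'/3.\<close>
  proof (rule landau_o.bigI[of "K' / 3 + 1"])
    show "K' / 3 + 1 > 0" using K'(1) by simp
    show "\<forall>\<^sub>F x in at_top. norm ((\<Sum>n | 1 \<le> n \<and> real n \<le> x. real (b_hex_pr n)) - 2 / (pi * sqrt 3) * x)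
        \<le> (K' / 3 + 1) * norm (sqrt x * ln x)"
      using eventually_ge_at_top[of "exp 1"]
    proof eventually_elim
      case (elim x)
      have x: "x \<ge> 1" using elim exp_ge_add_one_self[of 1] by linarith
      have ln: "ln x \<ge> 1" using elim x by (subst ln_ge_iff) auto
      have "2 / (pi * sqrt 3) * x = 2 * pi / sqrt 3 / (pi\<^sup>2 / 6) * x / 6"
        by (simp add: power2_eq_square)
      then have "\<bar>count_coprime x / 6 - 2 / (pi * sqrt 3) * x\<bar>
          = \<bar>count_coprime x - 2 * pi / sqrt 3 / (pi\<^sup>2 / 6) * x\<bar> / 6"
        by (simp only: diff_divide_distrib[symmetric]) simp
      also have "\<dots> \<le> K' * (sqrt x * (1 + ln x)) / 6" using K'(2)[OF x] by simp
      also have "\<dots> \<le> K' * (sqrt x * (2 * ln x)) / 6"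
        using K'(1) ln x by (intro divide_right_mono mult_left_mono) auto
      also have "\<dots> \<le> (K' / 3 + 1) * (sqrt x * ln x)" using x ln by (simp add: distrib_right)
      finally show ?case unfolding sum_b_hex_pr using x ln by simp
    qed
  qed
  show ?thesis unfolding const unfolding L_chi3_1 using 1 2 by blast
qed

end
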